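(* Let $p$ be a prime, $B_\epsilon=\{x\in\mathbb{Q}_p:|x|<\epsilon\}$ with $\epsilon=p^\gamma$, $\gamma\in\mathbb{Z}$, and let $\varphi\in\operatorname{Diff}^{\operatorname{an}}(B_\epsilon)$. For each $m$, the Frobenius Schwarzian derivative $S_m\{\varphi\}$ has the expression $$S_m\{\varphi\}(x)=\left(\frac{3p^m}{2}\left(\frac{D_x^2\varphi}{D_x\varphi}\right)^2+S\{\varphi\}(x)\right)(D_x\varphi)^{p^m}.$$ Therefore, the (pointwise) limit of $S_m\{\varphi\}$ as $m\to\infty$ is the Schwarzian $S\{\varphi\}$.
   Context: $|\cdot|$ is the $p$-adic absolute value on $\mathbb{Q}_p$; $C^{\operatorname{an}}(B_\epsilon)$ is the space of locally analytic functions $B_\epsilon\to\mathbb{Q}_p$; $D$ denotes differentiation. Let $\|Df\|_{\operatorname{lip}}:=\sup_{v_1\ne v_2\in B_\epsilon}|f(v_1)-f(v_2)|/|v_1-v_2|$ and $$\operatorname{Diff}^{\operatorname{an}}(B_\epsilon):=\{\varphi=\operatorname{id}+f: f\in C^{\operatorname{an}}(B_\epsilon),\ \|Df\|_{\operatorname{lip}}\le L<1 \text{ for some } L,\ f(0)=0\}.$$ With $\log$ the $p$-adic logarithm, put $V(y,z)=\log\left(\frac{\varphi(y)-\varphi(z)}{y-z}\right)$; the Schwarzian derivative is $S\{\varphi\}(x):=6D_yD_zV(y,z)|_{(y,z)=(x,x)}$, which equals $D_x^2u-\frac12(D_xu)^2$ with $u=\log(D_x\varphi)$. The Frobenius potential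 is $$V_m(y,z):=\frac{1}{p^m}\left\{\left(\frac{\varphi(y)-\varphi(z)}{y-z}\right)^{p^m}-1\right\},$$ and the Frobenius Schwarzian derivative is $S_m\{\varphi\}(x):=6D_yD_zV_m(y,z)|_{(y,z)=(x,x)}$. Difference quotients are extended to the diagonal by $D_x\varphi$. *)

theory Defs
  imports
    "HOL-Analysis.Analysis"
    "HOL-Library.Extended_Real"
    "Berlekamp_Zassenhaus.Finite_Field"
begin

section \<open>The field of p-adic numbers\<close>

subsection \<open>The p-adic absolute value on the rationals\<close>

definition rat_padic_abs :: "nat \<Rightarrow> rat \<Rightarrow> real" where
  "rat_padic_abs p x =
     (if x = 0 then 0
      else real p powi (int (multiplicity (int p) (snd (quotient_of x))) -
                        int (multiplicity (int p) (fst (quotient_of x)))))"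

lemma rat_padic_abs_divide:
  assumes p: "prime p" and "a \<noteq> 0" "b \<noteq> 0"
  shows "rat_padic_abs p (of_int a / of_int b) =
    real p powi (int (multiplicity (int p) b) - int (multiplicity (int p) a))"
proof -
  let ?x = "of_int a / of_int b :: rat"
  obtain c d where cd: "quotient_of ?x = (c, d)" by force
  have d: "d > 0" by (rule quotient_of_denom_pos[OF cd])
  have eq: "?x = of_int c / of_int d" by (rule quotient_of_div[OF cd])
  have x0: "?x \<noteq> 0" using assms by simp
  have c: "c \<noteq> 0" using eq x0 by auto
  have "(of_int (a * d) :: rat) = of_int (c * b)"
    using eq assms d by (simp add: field_simps)
  then have ad: "a * d = c * b" by (simp only: of_int_eq_iff)
  have pe: "prime_elem (int p)" using p by simp
  have "multiplicity (int p) a + multiplicity (int p) d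
      = multiplicity (int p) c + multiplicity (int p) b"
    using prime_elem_multiplicity_mult_distrib[OF pe, of a d]
      prime_elem_multiplicity_mult_distrib[OF pe, of c b] assms d c ad by simp
  then have "int (multiplicity (int p) d) - int (multiplicity (int p) c)
      = int (multiplicity (int p) b) - int (multiplicity (int p) a)" by linarith
  then show ?thesis
    using x0 cd by (simp add: rat_padic_abs_def)
qed

lemma rat_padic_abs_0 [simp]: "rat_padic_abs p 0 = 0"
  by (simp add: rat_padic_abs_def)

lemma rat_padic_abs_cases:
  obtains a b where "(x::rat) = of_int a / of_int b" "b > 0"
  by (metis quotient_of_denom_pos quotient_of_div surj_pair)

context
  fixes p :: nat
  assumes p: "prime p"
begin

lemma rat_padic_abs_ge_0 [simp]: "0 \<le> rat_padic_abs p x"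
  by (simp add: rat_padic_abs_def)

lemma rat_padic_abs_eq_0_iff [simp]: "rat_padic_abs p x = 0 \<longleftrightarrow> x = 0"
  using p by (auto simp: rat_padic_abs_def power_int_eq_0_iff)

lemma rat_padic_abs_mult: "rat_padic_abs p (x * y) = rat_padic_abs p x * rat_padic_abs p y"
proof (cases "x = 0 \<or> y = 0")
  case False
  obtain a b where x: "x = of_int a / of_int b" "b > 0" by (rule rat_padic_abs_cases)
  obtain c d where y: "y = of_int c / of_int d" "d > 0" by (rule rat_padic_abs_cases)
  have nz: "a \<noteq> 0" "c \<noteq> 0" "b \<noteq> 0" "d \<noteq> 0" using False x y by auto
  have pe: "prime_elem (int p)" using p by simp
  have p0: "real p \<noteq> 0" using p by auto
  have xy: "x * y = of_int (a * c) / of_int (b * d)" using x y by simp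
  show ?thesis
    unfolding xy unfolding x y
    using nz p0 p by (subst (1 2 3) rat_padic_abs_divide)
      (auto simp: prime_elem_multiplicity_mult_distrib[OF pe] algebra_simps
        simp flip: power_int_add)
qed auto

lemma rat_padic_abs_1 [simp]: "rat_padic_abs p 1 = 1"
  by (simp add: rat_padic_abs_def)

lemma rat_padic_abs_minus [simp]: "rat_padic_abs p (- x) = rat_padic_abs p x"
  using multiplicity_times_unit_right[of "-1" "int p"]
  by (simp add: rat_padic_abs_def rat_uminus_code Let_def split: prod.splits)

lemma rat_padic_abs_minus_commute: "rat_padic_abs p (x - y) = rat_padic_abs p (y - x)"
  using rat_padic_abs_minus[of "x - y"] by simp

lemma rat_padic_abs_inverse: "rat_padic_abs p (inverse x) = inverse (rat_padic_abs p x)"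
proof (cases "x = 0")
  case False
  have "rat_padic_abs p (inverse x) * rat_padic_abs p x = 1"
    using False by (simp flip: rat_padic_abs_mult)
  then show ?thesis
    by (metis inverse_unique mult.commute)
qed auto

lemma rat_padic_abs_add:
  "rat_padic_abs p (x + y) \<le> max (rat_padic_abs p x) (rat_padic_abs p y)"
proof (cases "x = 0 \<or> y = 0 \<or> x + y = 0")
  case True
  then show ?thesis by (auto simp: le_max_iff_disj)
next
  case False
  obtain a b where x: "x = of_int a / of_int b" "b > 0" by (rule rat_padic_abs_cases)
  obtain c d where y: "y = of_int c / of_int d" "d > 0" by (rule rat_padic_abs_cases)
  define u v n where "u = a * d" "v = c * b" "n = b * d"
  have n: "n \<noteq> 0" using x y by (simp add: u_v_n_def)
  have xu: "x = of_int u / of_int n" and yv: "y = of_int v / of_int n"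
    and xy: "x + y = of_int (u + v) / of_int n"
    using x y by (auto simp: u_v_n_def field_simps)
  have nz: "u \<noteq> 0" "v \<noteq> 0" "u + v \<noteq> 0" using False xu yv xy by auto
  let ?m = "multiplicity (int p)"
  have "int p ^ min (?m u) (?m v) dvd u + v"
    by (intro dvd_add multiplicity_dvd') auto
  then have "min (?m u) (?m v) \<le> ?m (u + v)"
    using nz p by (intro multiplicity_geI) auto
  then have "?m u \<le> ?m (u + v) \<or> ?m v \<le> ?m (u + v)" by auto
  moreover have "real p \<ge> 1" using prime_ge_1_nat[OF p] by simp
  ultimately have "real p powi (int (?m n) - int (?m (u + v))) \<le> real p powi (int (?m n) - int (?m u))
     \<or> real p powi (int (?m n) - int (?m (u + v))) \<le> real p powi (int (?m n) - int (?m v))"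
    by (auto intro!: power_int_increasing)
  then show ?thesis
    unfolding xy unfolding xu yv using nz n p
    by (simp add: rat_padic_abs_divide le_max_iff_disj del: of_int_add)
qed

lemma rat_padic_abs_triangle:
  "rat_padic_abs p (x + y) \<le> rat_padic_abs p x + rat_padic_abs p y"
  using rat_padic_abs_add[of x y] rat_padic_abs_ge_0[of x] rat_padic_abs_ge_0[of y] by linarith

lemma rat_padic_abs_diff_triangle:
  "\<bar>rat_padic_abs p x - rat_padic_abs p y\<bar> \<le> rat_padic_abs p (x - y)"
  using rat_padic_abs_triangle[of "x - y" y] rat_padic_abs_triangle[of "y - x" x]
    rat_padic_abs_minus_commute[of x y] by simp

end

subsection \<open>Cauchy and null sequences of rationals\<close>

definition padic_null :: "nat \<Rightarrow> (nat \<Rightarrow> rat) \<Rightarrow> bool" where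
  "padic_null p X \<longleftrightarrow> (\<lambda>n. rat_padic_abs p (X n)) \<longlonglongrightarrow> 0"

definition padic_cauchy :: "nat \<Rightarrow> (nat \<Rightarrow> rat) \<Rightarrow> bool" where
  "padic_cauchy p X \<longleftrightarrow> (\<forall>e>0. \<exists>M. \<forall>m\<ge>M. \<forall>n\<ge>M. rat_padic_abs p (X m - X n) < e)"

lemma padic_cauchy_const [simp]: "padic_cauchy p (\<lambda>n. c)"
  by (simp add: padic_cauchy_def)

lemma padic_null_0 [simp]: "padic_null p (\<lambda>n. 0)"
  by (simp add: padic_null_def)

context
  fixes p :: nat
  assumes p: "prime p"
begin

lemma padic_null_const [simp]: "padic_null p (\<lambda>n. c) \<longleftrightarrow> c = 0"
  using p by (simp add: padic_null_def LIMSEQ_const_iff)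

lemma padic_null_minus: "padic_null p X \<Longrightarrow> padic_null p (\<lambda>n. - X n)"
  using p by (simp add: padic_null_def)

lemma padic_null_le:
  assumes "f \<longlonglongrightarrow> 0" "\<And>n. rat_padic_abs p (X n) \<le> f n"
  shows "padic_null p X"
  unfolding padic_null_def
  by (rule tendsto_sandwich[OF _ _ tendsto_const assms(1)]) (use assms p in auto)

lemma padic_null_add:
  assumes "padic_null p X" "padic_null p Y"
  shows "padic_null p (\<lambda>n. X n + Y n)"
proof (rule padic_null_le)
  show "(\<lambda>n. rat_padic_abs p (X n) + rat_padic_abs p (Y n)) \<longlonglongrightarrow> 0"
    using tendsto_add[of _ 0 _ _ 0] assms unfolding padic_null_def by fastforce
qed (rule rat_padic_abs_triangle[OF p])

lemma padic_cauchy_abs_Cauchy: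
  assumes "padic_cauchy p X" shows "Cauchy (\<lambda>n. rat_padic_abs p (X n))"
proof (rule metric_CauchyI)
  fix e :: real assume "e > 0"
  then obtain M where "\<forall>m\<ge>M. \<forall>n\<ge>M. rat_padic_abs p (X m - X n) < e"
    using assms unfolding padic_cauchy_def by blast
  then show "\<exists>M. \<forall>m\<ge>M. \<forall>n\<ge>M. dist (rat_padic_abs p (X m)) (rat_padic_abs p (X n)) < e"
    unfolding dist_real_def using rat_padic_abs_diff_triangle[OF p] by (meson le_less_trans)
qed

lemma padic_cauchy_bounded:
  assumes "padic_cauchy p X" shows "\<exists>B>0. \<forall>n. rat_padic_abs p (X n) \<le> B"
  using Cauchy_Bseq[OF padic_cauchy_abs_Cauchy[OF assms]] p unfolding Bseq_def by auto

lemma padic_null_mult_bounded: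
  assumes "padic_cauchy p X" "padic_null p Y"
  shows "padic_null p (\<lambda>n. X n * Y n)"
proof -
  obtain B where B: "\<And>n. rat_padic_abs p (X n) \<le> B" using padic_cauchy_bounded[OF assms(1)] by blast
  show ?thesis
  proof (rule padic_null_le)
    show "(\<lambda>n. B * rat_padic_abs p (Y n)) \<longlonglongrightarrow> 0"
      using tendsto_mult_right_zero assms(2) unfolding padic_null_def by blast
    show "rat_padic_abs p (X n * Y n) \<le> B * rat_padic_abs p (Y n)" for n
      using B[of n] p by (simp add: rat_padic_abs_mult mult_right_mono)
  qed
qed

lemma padic_cauchy_add:
  assumes "padic_cauchy p X" "padic_cauchy p Y"
  shows "padic_cauchy p (\<lambda>n. X n + Y n)"
  unfolding padic_cauchy_def
proof (intro allI impI)
  fix e :: real assume e: "e > 0"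
  obtain M where M: "\<And>m n. m \<ge> M \<Longrightarrow> n \<ge> M \<Longrightarrow> rat_padic_abs p (X m - X n) < e"
    using assms(1) e unfolding padic_cauchy_def by blast
  obtain N where N: "\<And>m n. m \<ge> N \<Longrightarrow> n \<ge> N \<Longrightarrow> rat_padic_abs p (Y m - Y n) < e"
    using assms(2) e unfolding padic_cauchy_def by blast
  have "rat_padic_abs p (X m + Y m - (X n + Y n)) < e" if "m \<ge> max M N" "n \<ge> max M N" for m n
    using rat_padic_abs_add[OF p, of "X m - X n" "Y m - Y n"] M[of m n] N[of m n] that
    by (simp add: add_diff_add)
  then show "\<exists>M. \<forall>m\<ge>M. \<forall>n\<ge>M. rat_padic_abs p (X m + Y m - (X n + Y n)) < e" by blast
qed

lemma padic_cauchy_minus: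
  assumes "padic_cauchy p X" shows "padic_cauchy p (\<lambda>n. - X n)"
  using assms rat_padic_abs_minus[OF p] unfolding padic_cauchy_def minus_diff_minus by metis

lemma padic_cauchy_mult:
  assumes "padic_cauchy p X" "padic_cauchy p Y"
  shows "padic_cauchy p (\<lambda>n. X n * Y n)"
  unfolding padic_cauchy_def
proof (intro allI impI)
  fix e :: real assume e: "e > 0"
  obtain A where A: "A > 0" "\<And>n. rat_padic_abs p (X n) \<le> A" using padic_cauchy_bounded[OF assms(1)] by blast
  obtain B where B: "B > 0" "\<And>n. rat_padic_abs p (Y n) \<le> B" using padic_cauchy_bounded[OF assms(2)] by blast
  obtain M where M: "\<And>m n. m \<ge> M \<Longrightarrow> n \<ge> M \<Longrightarrow> rat_padic_abs p (X m - X n) < e / B"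
    using assms(1) divide_pos_pos[OF e B(1)] unfolding padic_cauchy_def by blast
  obtain N where N: "\<And>m n. m \<ge> N \<Longrightarrow> n \<ge> N \<Longrightarrow> rat_padic_abs p (Y m - Y n) < e / A"
    using assms(2) divide_pos_pos[OF e A(1)] unfolding padic_cauchy_def by blast
  have "rat_padic_abs p (X m * Y m - X n * Y n) < e" if mn: "m \<ge> max M N" "n \<ge> max M N" for m n
  proof -
    have "rat_padic_abs p (X m * (Y m - Y n)) \<le> A * rat_padic_abs p (Y m - Y n)"
      using A(2)[of m] p by (simp add: rat_padic_abs_mult mult_right_mono)
    also have "\<dots> < e" using N[of m n] mn A(1) by (simp add: field_simps)
    finally have 1: "rat_padic_abs p (X m * (Y m - Y n)) < e" .
    have "rat_padic_abs p ((X m - X n) * Y n) \<le> rat_padic_abs p (X m - X n) * B"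
      using B(2)[of n] p by (simp add: rat_padic_abs_mult mult_left_mono)
    also have "\<dots> < e" using M[of m n] mn B(1) by (simp add: field_simps)
    finally show ?thesis
      using 1 rat_padic_abs_add[OF p, of "X m * (Y m - Y n)" "(X m - X n) * Y n"]
      by (simp add: mult_diff_mult)
  qed
  then show "\<exists>M. \<forall>m\<ge>M. \<forall>n\<ge>M. rat_padic_abs p (X m * Y m - X n * Y n) < e" by blast
qed

lemma padic_not_null:
  assumes "padic_cauchy p X" "\<not> padic_null p X"
  obtains b k where "b > 0" "\<And>n. n \<ge> k \<Longrightarrow> b < rat_padic_abs p (X n)"
proof -
  obtain l where l: "(\<lambda>n. rat_padic_abs p (X n)) \<longlonglongrightarrow> l"
    using padic_cauchy_abs_Cauchy[OF assms(1)] Cauchy_convergent convergent_def by blast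
  have "l \<ge> 0" by (rule LIMSEQ_le_const[OF l]) (use p in auto)
  moreover have "l \<noteq> 0" using assms(2) l by (auto simp: padic_null_def)
  ultimately have l0: "l / 2 < l" "l / 2 > 0" by auto
  show thesis
    using order_tendstoD(1)[OF l l0(1)] that l0(2) unfolding eventually_sequentially by blast
qed

lemma rat_padic_abs_inverse_diff_less:
  assumes "b > 0" "c > 0" "b < rat_padic_abs p x" "c < rat_padic_abs p y"
    and "rat_padic_abs p (x - y) < e * b * c"
  shows "rat_padic_abs p (inverse x - inverse y) < e"
proof -
  have nz: "x \<noteq> 0" "y \<noteq> 0" using assms by auto
  have "b * c < rat_padic_abs p x * rat_padic_abs p y"
    using assms by (intro mult_strict_mono) auto
  moreover have "e > 0"
  proof -
    have "0 < e * (b * c)" using assms(5) rat_padic_abs_ge_0[OF p, of "x - y"] by (simp add: mult.assoc)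
    moreover have "b * c > 0" using assms(1,2) by simp
    ultimately show ?thesis by (rule zero_less_mult_pos2)
  qed
  ultimately have "e * b * c \<le> e * (rat_padic_abs p x * rat_padic_abs p y)"
    by (simp add: mult.assoc)
  then have "rat_padic_abs p (x - y) < e * (rat_padic_abs p x * rat_padic_abs p y)"
    using assms(5) by linarith
  moreover have "rat_padic_abs p x * rat_padic_abs p y > 0"
    using assms by (intro mult_pos_pos) auto
  moreover have "rat_padic_abs p (inverse x - inverse y)
      = rat_padic_abs p (x - y) / (rat_padic_abs p x * rat_padic_abs p y)"
    using nz by (simp add: inverse_diff_inverse rat_padic_abs_mult[OF p] rat_padic_abs_inverse[OF p]
        rat_padic_abs_minus[OF p] divide_inverse del: minus_mult_left minus_mult_right)
  ultimately show ?thesis by (simp add: divide_less_eq)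
qed

lemma padic_cauchy_inverse:
  assumes "padic_cauchy p X" "\<not> padic_null p X"
  shows "padic_cauchy p (\<lambda>n. inverse (X n))"
  unfolding padic_cauchy_def
proof (intro allI impI)
  fix e :: real assume e: "e > 0"
  obtain b k where b: "b > 0" "\<And>n. n \<ge> k \<Longrightarrow> b < rat_padic_abs p (X n)"
    using padic_not_null[OF assms] by metis
  have "e * b * b > 0" using e b by simp
  then obtain M where M: "\<And>m n. m \<ge> M \<Longrightarrow> n \<ge> M \<Longrightarrow> rat_padic_abs p (X m - X n) < e * b * b"
    using assms(1) unfolding padic_cauchy_def by blast
  have "rat_padic_abs p (inverse (X m) - inverse (X n)) < e" if "m \<ge> max M k" "n \<ge> max M k" for m n
    using that b M by (intro rat_padic_abs_inverse_diff_less[of b b]) auto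
  then show "\<exists>M. \<forall>m\<ge>M. \<forall>n\<ge>M. rat_padic_abs p (inverse (X m) - inverse (X n)) < e" by blast
qed

lemma padic_null_diff_inverse:
  assumes X: "padic_cauchy p X" "\<not> padic_null p X"
    and Y: "padic_cauchy p Y" "\<not> padic_null p Y"
    and XY: "padic_null p (\<lambda>n. X n - Y n)"
  shows "padic_null p (\<lambda>n. inverse (X n) - inverse (Y n))"
proof -
  obtain b k where b: "b > 0" "\<And>n. n \<ge> k \<Longrightarrow> b < rat_padic_abs p (X n)"
    using padic_not_null[OF X] by metis
  obtain c l where c: "c > 0" "\<And>n. n \<ge> l \<Longrightarrow> c < rat_padic_abs p (Y n)"
    using padic_not_null[OF Y] by metis
  show ?thesis
    unfolding padic_null_def
  proof (rule order_tendstoI)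
    fix a :: real assume "a < 0"
    then show "\<forall>\<^sub>F n in sequentially. a < rat_padic_abs p (inverse (X n) - inverse (Y n))"
      using less_le_trans[OF _ rat_padic_abs_ge_0[OF p]] by (intro always_eventually allI) blast
  next
    fix e :: real assume "0 < e"
    then have "e * b * c > 0" using b c by simp
    then have "\<forall>\<^sub>F n in sequentially. rat_padic_abs p (X n - Y n) < e * b * c"
      using XY order_tendstoD(2) unfolding padic_null_def by blast
    then show "\<forall>\<^sub>F n in sequentially. rat_padic_abs p (inverse (X n) - inverse (Y n)) < e"
      using eventually_ge_at_top[of k] eventually_ge_at_top[of l]
      by eventually_elim (use b c in \<open>auto intro: rat_padic_abs_inverse_diff_less[of b c]\<close>)
  qed
qed

end

subsection \<open>The type of p-adic numbers\<close>

text \<open>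
  \<open>'p padic\<close> is the completion of the rationals with respect to the p-adic absolute value, built
  from Cauchy sequences, where the prime p is the cardinality of the index type \<open>'p\<close>.
\<close>

definition padic_rel :: "'p::prime_card itself \<Rightarrow> (nat \<Rightarrow> rat) \<Rightarrow> (nat \<Rightarrow> rat) \<Rightarrow> bool" where
  "padic_rel _ X Y \<longleftrightarrow>
     padic_cauchy CARD('p) X \<and> padic_cauchy CARD('p) Y \<and> padic_null CARD('p) (\<lambda>n. X n - Y n)"

lemma part_equivp_padic_rel: "part_equivp (padic_rel TYPE('p::prime_card))"
proof (rule part_equivpI)
  show "\<exists>X. padic_rel TYPE('p) X X"
    by (rule exI[of _ "\<lambda>_. 0"]) (simp add: padic_rel_def)
  show "symp (padic_rel TYPE('p))"
    using padic_null_minus[OF prime_card[where 'a = 'p], of "\<lambda>n. X n - Y n" for X Y]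
    unfolding padic_rel_def by (intro sympI) fastforce
  show "transp (padic_rel TYPE('p))"
    using padic_null_add[OF prime_card[where 'a = 'p]]
    unfolding padic_rel_def by (intro transpI) fastforce
qed

typedef (overloaded) 'p padic =
  "{C. \<exists>X. padic_rel TYPE('p::prime_card) X X \<and> C = Collect (padic_rel TYPE('p) X)}"
  by (auto intro!: exI[of _ "\<lambda>_. 0"] simp: padic_rel_def)

definition Padic :: "(nat \<Rightarrow> rat) \<Rightarrow> 'p::prime_card padic" where
  "Padic X = Abs_padic (Collect (padic_rel TYPE('p) X))"

definition rep_padic :: "'p::prime_card padic \<Rightarrow> nat \<Rightarrow> rat" where
  "rep_padic x = (SOME X. X \<in> Rep_padic x)"

definition cr_padic :: "(nat \<Rightarrow> rat) \<Rightarrow> 'p::prime_card padic \<Rightarrow> bool" where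
  "cr_padic X x \<longleftrightarrow> padic_rel TYPE('p) X X \<and> Padic X = x"

lemma Quotient_padic:
  "Quotient (padic_rel TYPE('p::prime_card)) Padic rep_padic (cr_padic :: _ \<Rightarrow> 'p padic \<Rightarrow> bool)"
proof (rule Quotient3_to_Quotient)
  interpret quot_type "padic_rel TYPE('p)" "Abs_padic :: _ \<Rightarrow> 'p padic" Rep_padic
    using Rep_padic part_equivp_padic_rel
    by unfold_locales (auto simp: Rep_padic_inverse Rep_padic_inject Abs_padic_inverse)
  have "abs = Padic" "rep = rep_padic"
    by (auto simp: abs_def Padic_def rep_def rep_padic_def)
  then show "Quotient3 (padic_rel TYPE('p)) (Padic :: _ \<Rightarrow> 'p padic) rep_padic"
    using Quotient by simp
  show "(cr_padic :: _ \<Rightarrow> 'p padic \<Rightarrow> bool) \<equiv> \<lambda>X x. padic_rel TYPE('p) X X \<and> Padic X = x"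
    by (rule eq_reflection) (simp add: cr_padic_def fun_eq_iff)
qed

setup_lifting Quotient_padic

lemma padic_rel_refl: "padic_cauchy CARD('p::prime_card) X \<Longrightarrow> padic_rel TYPE('p) X X"
  by (simp add: padic_rel_def)

instantiation padic :: (prime_card) field
begin

lift_definition zero_padic :: "'a padic" is "\<lambda>n. 0"
  by (simp add: padic_rel_def)

lift_definition one_padic :: "'a padic" is "\<lambda>n. 1"
  by (simp add: padic_rel_def)

lift_definition plus_padic :: "'a padic \<Rightarrow> 'a padic \<Rightarrow> 'a padic" is "\<lambda>X Y n. X n + Y n"
  unfolding padic_rel_def add_diff_add
  by (simp add: padic_cauchy_add[OF prime_card] padic_null_add[OF prime_card])

lift_definition uminus_padic :: "'a padic \<Rightarrow> 'a padic" is "\<lambda>X n. - X n"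
  unfolding padic_rel_def minus_diff_minus
  by (auto simp: padic_cauchy_minus[OF prime_card] dest: padic_null_minus[OF prime_card])

lift_definition times_padic :: "'a padic \<Rightarrow> 'a padic \<Rightarrow> 'a padic" is "\<lambda>X Y n. X n * Y n"
proof -
  fix X X' Y Y' :: "nat \<Rightarrow> rat"
  assume "padic_rel TYPE('a) X X'" "padic_rel TYPE('a) Y Y'"
  then have c: "padic_cauchy CARD('a) X" "padic_cauchy CARD('a) X'"
      "padic_cauchy CARD('a) Y" "padic_cauchy CARD('a) Y'"
    and n: "padic_null CARD('a) (\<lambda>n. X n - X' n)" "padic_null CARD('a) (\<lambda>n. Y n - Y' n)"
    by (auto simp: padic_rel_def)
  have "padic_null CARD('a) (\<lambda>n. X n * (Y n - Y' n) + Y' n * (X n - X' n))"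
    by (intro padic_null_add[OF prime_card] padic_null_mult_bounded[OF prime_card] c n)
  then show "padic_rel TYPE('a) (\<lambda>n. X n * Y n) (\<lambda>n. X' n * Y' n)"
    using c by (simp add: padic_rel_def padic_cauchy_mult[OF prime_card] mult_diff_mult mult.commute)
qed

lift_definition inverse_padic :: "'a padic \<Rightarrow> 'a padic"
  is "\<lambda>X. if padic_null CARD('a) X then (\<lambda>n. 0) else (\<lambda>n. inverse (X n))"
proof -
  fix X Y :: "nat \<Rightarrow> rat"
  assume "padic_rel TYPE('a) X Y"
  then have c: "padic_cauchy CARD('a) X" "padic_cauchy CARD('a) Y"
    and n: "padic_null CARD('a) (\<lambda>n. X n - Y n)"
    by (auto simp: padic_rel_def)
  have "padic_null CARD('a) X \<longleftrightarrow> padic_null CARD('a) Y"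
    using padic_null_add[OF prime_card n, of Y]
      padic_null_add[OF prime_card padic_null_minus[OF prime_card n], of X] by auto
  then show "?thesis X Y"
    using c n by (simp add: padic_rel_def padic_cauchy_inverse[OF prime_card]
        padic_null_diff_inverse[OF prime_card])
qed

definition minus_padic :: "'a padic \<Rightarrow> 'a padic \<Rightarrow> 'a padic" where
  "minus_padic x y = x + - y"

definition divide_padic :: "'a padic \<Rightarrow> 'a padic \<Rightarrow> 'a padic" where
  "divide_padic x y = x * inverse y"

instance
proof
  fix a b c :: "'a padic"
  note simps = padic_rel_def padic_cauchy_add[OF prime_card] padic_cauchy_minus[OF prime_card]
    padic_cauchy_mult[OF prime_card] padic_null_const[OF prime_card]
  show "a + b + c = a + (b + c)" by transfer (simp add: simps ac_simps)
  show "a + b = b + a" by transfer (simp add: simps ac_simps)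
  show "0 + a = a" by transfer (simp add: simps)
  show "- a + a = 0" by transfer (simp add: simps)
  show "a - b = a + - b" by (rule minus_padic_def)
  show "a * b * c = a * (b * c)" by transfer (simp add: simps ac_simps)
  show "a * b = b * a" by transfer (simp add: simps ac_simps)
  show "1 * a = a" by transfer (simp add: simps)
  show "(a + b) * c = a * c + b * c" by transfer (simp add: simps distrib_right)
  show "(0 :: 'a padic) \<noteq> 1" by transfer (simp add: simps)
  have "padic_null CARD('a) (\<lambda>n. inverse (X n) * X n - 1)"
    if X: "padic_cauchy CARD('a) X" "\<not> padic_null CARD('a) X" for X
  proof -
    obtain b k where b: "b > 0" "\<And>n. n \<ge> k \<Longrightarrow> b < rat_padic_abs CARD('a) (X n)"
      using padic_not_null[OF prime_card X] by metis
    then have "X n \<noteq> 0" if "n \<ge> k" for n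
      using that by (metis less_asym rat_padic_abs_0)
    then have "inverse (X n) * X n - 1 = 0" if "n \<ge> k" for n
      using that by simp
    then have "\<forall>\<^sub>F n in sequentially. rat_padic_abs CARD('a) (inverse (X n) * X n - 1) = 0"
      unfolding eventually_sequentially by (metis rat_padic_abs_0)
    then show ?thesis
      unfolding padic_null_def by (rule tendsto_eventually)
  qed
  then show "a \<noteq> 0 \<Longrightarrow> inverse a * a = 1"
    by transfer (simp add: simps padic_cauchy_inverse[OF prime_card])
  show "a div b = a * inverse b" by (rule divide_padic_def)
  show "inverse (0 :: 'a padic) = 0" by transfer (simp add: simps)
qed

end

subsection \<open>The absolute value, the metric and completeness\<close>

lift_definition padic_abs :: "'p::prime_card padic \<Rightarrow> real"
  is "\<lambda>X. lim (\<lambda>n. rat_padic_abs CARD('p) (X n))"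
proof -
  fix X Y :: "nat \<Rightarrow> rat"
  assume "padic_rel TYPE('p) X Y"
  then have c: "padic_cauchy CARD('p) X" "padic_cauchy CARD('p) Y"
    and n: "padic_null CARD('p) (\<lambda>n. X n - Y n)"
    by (auto simp: padic_rel_def)
  let ?a = "rat_padic_abs CARD('p)"
  obtain l where l: "(\<lambda>n. ?a (Y n)) \<longlonglongrightarrow> l"
    using padic_cauchy_abs_Cauchy[OF prime_card c(2)] Cauchy_convergent convergent_def by blast
  have "(\<lambda>n. ?a (X n) - ?a (Y n)) \<longlonglongrightarrow> 0"
    by (rule Lim_null_comparison[OF _ n[unfolded padic_null_def]])
       (simp add: rat_padic_abs_diff_triangle[OF prime_card])
  from tendsto_add[OF this l] have "(\<lambda>n. ?a (X n)) \<longlonglongrightarrow> l" by simp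
  then show "lim (\<lambda>n. ?a (X n)) = lim (\<lambda>n. ?a (Y n))"
    using l by (simp add: limI)
qed

lemma padic_cauchy_abs_tendsto:
  assumes "padic_cauchy CARD('p::prime_card) X"
  shows "(\<lambda>n. rat_padic_abs CARD('p) (X n)) \<longlonglongrightarrow> lim (\<lambda>n. rat_padic_abs CARD('p) (X n))"
  using padic_cauchy_abs_Cauchy[OF prime_card assms] Cauchy_convergent convergent_LIMSEQ_iff by blast

lemma padic_abs_eq_0_iff [simp]: "padic_abs x = 0 \<longleftrightarrow> x = 0"
proof (transfer, goal_cases)
  case (1 X)
  then have c: "padic_cauchy CARD('a) X" by (simp add: padic_rel_def)
  have "lim (\<lambda>n. rat_padic_abs CARD('a) (X n)) = 0 \<longleftrightarrow> padic_null CARD('a) X"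
    unfolding padic_null_def using padic_cauchy_abs_tendsto[OF c] by (metis limI)
  then show ?case using c by (simp add: padic_rel_def)
qed

lemma padic_abs_ge_0 [simp]: "0 \<le> padic_abs x"
proof (transfer, goal_cases)
  case (1 X)
  then have "padic_cauchy CARD('a) X" by (simp add: padic_rel_def)
  then show ?case
    by (rule LIMSEQ_le_const[OF padic_cauchy_abs_tendsto]) (simp add: rat_padic_abs_ge_0[OF prime_card])
qed

lemma padic_abs_mult: "padic_abs (x * y) = padic_abs x * padic_abs y"
proof (transfer, goal_cases)
  case (1 X Y)
  then have "padic_cauchy CARD('a) X" "padic_cauchy CARD('a) Y" by (simp_all add: padic_rel_def)
  then show ?case
    using tendsto_mult[OF padic_cauchy_abs_tendsto[where 'p = 'a, of X]
        padic_cauchy_abs_tendsto[where 'p = 'a, of Y]]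
    by (simp add: rat_padic_abs_mult[OF prime_card] limI)
qed

lemma padic_abs_minus [simp]: "padic_abs (- x) = padic_abs x"
  by transfer (simp add: rat_padic_abs_minus[OF prime_card])

lemma padic_abs_add: "padic_abs (x + y) \<le> max (padic_abs x) (padic_abs y)"
proof (transfer, goal_cases)
  case (1 X Y)
  then have "padic_cauchy CARD('a) X" "padic_cauchy CARD('a) Y" by (simp_all add: padic_rel_def)
  then show ?case
    by (intro LIMSEQ_le[OF padic_cauchy_abs_tendsto
          tendsto_max[OF padic_cauchy_abs_tendsto padic_cauchy_abs_tendsto]]
          padic_cauchy_add[OF prime_card])
       (auto simp: rat_padic_abs_add[OF prime_card])
qed

lemma of_nat_padic: "(of_nat k :: 'p::prime_card padic) = Padic (\<lambda>_. of_nat k)"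
proof (induction k)
  case 0
  show ?case by (simp add: zero_padic.abs_eq)
next
  case (Suc k)
  have "Padic (\<lambda>_. 1) + Padic (\<lambda>_. of_nat k) = (Padic (\<lambda>_. 1 + of_nat k) :: 'p padic)"
    by (rule plus_padic.abs_eq) (simp_all add: padic_rel_refl)
  with Suc show ?case by (simp add: one_padic.abs_eq)
qed

lemma padic_abs_Padic:
  assumes "padic_cauchy CARD('p::prime_card) X"
  shows "padic_abs (Padic X :: 'p padic) = lim (\<lambda>n. rat_padic_abs CARD('p) (X n))"
  using assms by (intro padic_abs.abs_eq) (simp add: padic_rel_refl)

instance padic :: (prime_card) field_char_0
proof
  show "inj (of_nat :: nat \<Rightarrow> 'a padic)"
  proof (rule injI)
    fix k l assume "(of_nat k :: 'a padic) = of_nat l"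
    then have "padic_rel TYPE('a) (\<lambda>_. of_nat k) (\<lambda>_. of_nat l)"
      unfolding of_nat_padic using Quotient_rel[OF Quotient_padic] padic_rel_refl padic_cauchy_const
      by blast
    then show "k = l"
      by (simp add: padic_rel_def padic_null_const[OF prime_card])
  qed
qed

instantiation padic :: (prime_card) metric_space
begin

definition dist_padic :: "'a padic \<Rightarrow> 'a padic \<Rightarrow> real" where
  "dist_padic x y = padic_abs (x - y)"

definition uniformity_padic :: "('a padic \<times> 'a padic) filter" where
  "uniformity_padic = (INF e\<in>{0<..}. principal {(x, y). dist x y < e})"

definition open_padic :: "'a padic set \<Rightarrow> bool" where
  "open_padic U \<longleftrightarrow> (\<forall>x\<in>U. \<forall>\<^sub>F (x', y) in uniformity. x' = x \<longrightarrow> y \<in> U)"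

instance
proof
  fix x y z :: "'a padic"
  show "(uniformity :: ('a padic \<times> 'a padic) filter) = (INF e\<in>{0<..}. principal {(x, y). dist x y < e})"
    by (rule uniformity_padic_def)
  show "open U \<longleftrightarrow> (\<forall>x\<in>U. \<forall>\<^sub>F (x', y) in uniformity. x' = x \<longrightarrow> y \<in> U)" for U :: "'a padic set"
    by (rule open_padic_def)
  show "dist x y = 0 \<longleftrightarrow> x = y" by (simp add: dist_padic_def)
  have "padic_abs (x - y) \<le> max (padic_abs (x - z)) (padic_abs (- (y - z)))"
    using padic_abs_add[of "x - z" "- (y - z)"] by simp
  also have "\<dots> \<le> padic_abs (x - z) + padic_abs (y - z)"
    unfolding padic_abs_minus using padic_abs_ge_0[of "x - z"] padic_abs_ge_0[of "y - z"] by linarith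
  finally show "dist x y \<le> dist x z + dist y z"
    unfolding dist_padic_def .
qed

end

lemma of_int_padic: "(of_int k :: 'p::prime_card padic) = Padic (\<lambda>_. of_int k)"
proof (cases k rule: int_cases2)
  case (nonneg n)
  then show ?thesis by (simp add: of_nat_padic)
next
  case (nonpos n)
  have "- Padic (\<lambda>_. of_nat n) = (Padic (\<lambda>_. - of_nat n) :: 'p padic)"
    by (rule uminus_padic.abs_eq) (simp_all add: padic_rel_refl)
  with nonpos show ?thesis by (simp add: of_nat_padic)
qed

lemma of_rat_padic: "(of_rat q :: 'p::prime_card padic) = Padic (\<lambda>_. q)"
proof -
  obtain a b where q: "q = of_int a / of_int b" "b > 0" by (rule rat_padic_abs_cases)
  have "Padic (\<lambda>_. q) * Padic (\<lambda>_. of_int b) = (Padic (\<lambda>_. q * of_int b) :: 'p padic)"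
    by (rule times_padic.abs_eq) (simp_all add: padic_rel_refl)
  also have "(\<lambda>_::nat. q * of_int b) = (\<lambda>_. of_int a)" using q by simp
  finally have "Padic (\<lambda>_. q) * of_int b = (of_int a :: 'p padic)" by (simp add: of_int_padic)
  then have "Padic (\<lambda>_. q) = (of_int a / of_int b :: 'p padic)"
    using q(2) nonzero_eq_divide_eq[of "of_int b :: 'p padic"] by simp
  then show ?thesis using q(1) by (simp add: of_rat_divide)
qed

lemma padic_abs_of_rat:
  "padic_abs (of_rat q :: 'p::prime_card padic) = rat_padic_abs CARD('p) q"
  by (simp add: of_rat_padic padic_abs_Padic limI)

lemma padic_abs_Padic_diff_of_rat:
  assumes X: "padic_cauchy CARD('p::prime_card) X"
    and le: "\<And>n. n \<ge> N \<Longrightarrow> rat_padic_abs CARD('p) (X n - q) \<le> e"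
  shows "padic_abs (Padic X - (of_rat q :: 'p padic)) \<le> e"
proof -
  have c: "padic_cauchy CARD('p) (\<lambda>n. X n + - q)"
    by (rule padic_cauchy_add[OF prime_card X]) simp
  have "- of_rat q = (Padic (\<lambda>_. - q) :: 'p padic)"
    by (simp flip: of_rat_padic add: of_rat_minus)
  moreover have "Padic X + Padic (\<lambda>_. - q) = (Padic (\<lambda>n. X n + - q) :: 'p padic)"
    by (rule plus_padic.abs_eq) (simp_all add: padic_rel_refl X)
  ultimately have "Padic X - of_rat q = (Padic (\<lambda>n. X n + - q) :: 'p padic)"
    by (simp only: diff_conv_add_uminus)
  then have "padic_abs (Padic X - (of_rat q :: 'p padic)) = lim (\<lambda>n. rat_padic_abs CARD('p) (X n + - q))"
    using padic_abs_Padic[OF c] by simp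
  also have "\<dots> \<le> e"
    by (rule LIMSEQ_le_const2[OF padic_cauchy_abs_tendsto[OF c]]) (use le in auto)
  finally show ?thesis .
qed

lemma padic_rat_dense:
  fixes x :: "'p::prime_card padic"
  assumes "e > 0"
  obtains q where "padic_abs (x - of_rat q) < e"
proof -
  define X where "X = rep_padic x"
  have rel: "padic_rel TYPE('p) X X" and x: "Padic X = x"
    unfolding X_def
    by (rule Quotient_rep_reflp[OF Quotient_padic], rule Quotient_abs_rep[OF Quotient_padic])
  have c: "padic_cauchy CARD('p) X" using rel by (simp add: padic_rel_def)
  obtain M where "\<forall>m\<ge>M. \<forall>n\<ge>M. rat_padic_abs CARD('p) (X m - X n) < e / 2"
    using c half_gt_zero[OF assms] unfolding padic_cauchy_def by blast
  then have "rat_padic_abs CARD('p) (X n - X M) \<le> e / 2" if "n \<ge> M" for n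
    using that by (meson le_refl less_imp_le)
  then have "padic_abs (x - of_rat (X M)) \<le> e / 2"
    using padic_abs_Padic_diff_of_rat[OF c] x by blast
  with assms that[of "X M"] show thesis by simp
qed

instance padic :: (prime_card) complete_space
proof
  fix X :: "nat \<Rightarrow> 'a padic"
  assume X: "Cauchy X"
  have "\<exists>q. padic_abs (X n - of_rat q) < 1 / real (Suc n)" for n
    using padic_rat_dense[of "1 / real (Suc n)" "X n"] by auto
  then obtain q where q: "\<And>n. padic_abs (X n - of_rat (q n)) < 1 / real (Suc n)" by metis
  have tri: "padic_abs (a - c) < e" if "padic_abs (a - b) < e" "padic_abs (b - c) < e"
    for a b c :: "'a padic" and e
    using padic_abs_add[of "a - b" "b - c"] that by simp
  have comm: "padic_abs (a - b) = padic_abs (b - a)" for a b :: "'a padic"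
    using padic_abs_minus[of "a - b"] by simp
  have small: "\<exists>N. \<forall>n\<ge>N. padic_abs (X n - of_rat (q n)) < e" if e: "e > 0" for e
  proof -
    obtain N where N: "1 / real (Suc N) < e" using nat_approx_posE[OF e] by blast
    have "padic_abs (X n - of_rat (q n)) < e" if "n \<ge> N" for n
    proof -
      have "1 / real (Suc n) \<le> 1 / real (Suc N)" using that by (intro divide_left_mono) auto
      then show ?thesis using q[of n] N by linarith
    qed
    then show ?thesis by blast
  qed
  have c: "padic_cauchy CARD('a) q"
    unfolding padic_cauchy_def
  proof (intro allI impI)
    fix e :: real assume e: "e > 0"
    obtain N where N: "\<And>n. n \<ge> N \<Longrightarrow> padic_abs (X n - of_rat (q n)) < e"
      using small[OF e] by blast
    obtain M where M: "\<And>m n. m \<ge> M \<Longrightarrow> n \<ge> M \<Longrightarrow> padic_abs (X m - X n) < e"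
      using metric_CauchyD[OF X e] unfolding dist_padic_def by blast
    have "rat_padic_abs CARD('a) (q m - q n) < e" if "m \<ge> max M N" "n \<ge> max M N" for m n
    proof -
      have "padic_abs (of_rat (q m) - X m) < e" using N[of m] that comm[of "X m"] by simp
      then have "padic_abs (of_rat (q m) - (of_rat (q n) :: 'a padic)) < e"
        using M[of m n] N[of n] that by (auto intro: tri[of _ "X m"] tri[of "X m" "X n"])
      then show ?thesis by (simp flip: of_rat_diff add: padic_abs_of_rat)
    qed
    then show "\<exists>M. \<forall>m\<ge>M. \<forall>n\<ge>M. rat_padic_abs CARD('a) (q m - q n) < e" by blast
  qed
  have "X \<longlonglongrightarrow> Padic q"
  proof (rule metric_LIMSEQ_I)
    fix e :: real assume e: "e > 0"
    obtain N where N: "\<And>n. n \<ge> N \<Longrightarrow> padic_abs (X n - of_rat (q n)) < e"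
      using small[OF e] by blast
    obtain M where M: "\<And>m n. m \<ge> M \<Longrightarrow> n \<ge> M \<Longrightarrow> rat_padic_abs CARD('a) (q m - q n) < e / 2"
      using c half_gt_zero[OF e] unfolding padic_cauchy_def by blast
    have "dist (X n) (Padic q) < e" if "n \<ge> max M N" for n
    proof -
      have "padic_abs (Padic q - (of_rat (q n) :: 'a padic)) \<le> e / 2"
        using M[of _ n] that by (intro padic_abs_Padic_diff_of_rat[OF c, of M]) (simp add: less_imp_le)
      then have "padic_abs (of_rat (q n) - (Padic q :: 'a padic)) < e"
        using comm[of "Padic q"] e by simp
      then show ?thesis
        unfolding dist_padic_def using N[of n] that by (auto intro: tri)
    qed
    then show "\<exists>N. \<forall>n\<ge>N. dist (X n) (Padic q) < e" by blast
  qed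
  then show "convergent X" by (auto simp: convergent_def)
qed


section \<open>Analysis over the p-adic numbers\<close>

definition padic_ball :: "real \<Rightarrow> 'p::prime_card padic set" where
  "padic_ball \<epsilon> = {x. padic_abs x < \<epsilon>}"

text \<open>
  Functions on a ball are represented by total functions of which only the values on the ball
  matter; since balls are open, derivatives at points of the ball do not depend on the extension.
\<close>

definition padic_deriv :: "('p::prime_card padic \<Rightarrow> 'p padic) \<Rightarrow> 'p padic \<Rightarrow> 'p padic" where
  "padic_deriv f x = Lim (at x) (\<lambda>y. (f y - f x) / (y - x))"

definition locally_analytic_on ::
  "('p::prime_card padic \<Rightarrow> 'p padic) \<Rightarrow> 'p padic set \<Rightarrow> bool"  (infix "locally'_analytic'_on" 50) where
  "f locally_analytic_on B \<longleftrightarrow>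
     (\<forall>a\<in>B. \<exists>r>0. \<exists>c. \<forall>x\<in>B. padic_abs (x - a) < r \<longrightarrow> (\<lambda>n. c n * (x - a) ^ n) sums f x)"

definition lip_seminorm :: "'p::prime_card padic set \<Rightarrow> ('p padic \<Rightarrow> 'p padic) \<Rightarrow> ereal" where
  "lip_seminorm B f =
     (SUP (v, w)\<in>{(v, w). v \<in> B \<and> w \<in> B \<and> v \<noteq> w}. ereal (padic_abs (f v - f w) / padic_abs (v - w)))"

definition Diff_an :: "real \<Rightarrow> ('p::prime_card padic \<Rightarrow> 'p padic) set" where
  "Diff_an \<epsilon> =
     {\<phi>. \<exists>f. (\<forall>x\<in>padic_ball \<epsilon>. \<phi> x = x + f x) \<and> f locally_analytic_on padic_ball \<epsilon> \<and>
          (\<exists>L<1. lip_seminorm (padic_ball \<epsilon>) f \<le> ereal L) \<and> f 0 = 0}"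

text \<open>
  The p-adic logarithm, given by its power series at 1; it converges exactly for
  \<open>padic_abs (x - 1) < 1\<close>, which holds for all difference quotients of an element of
  \<open>Diff_an \<epsilon>\<close> on the ball.
\<close>

definition padic_log :: "'p::prime_card padic \<Rightarrow> 'p padic" where
  "padic_log x = (\<Sum>n. (- 1) ^ n * (x - 1) ^ Suc n / of_nat (Suc n))"

definition diff_quot ::
  "('p::prime_card padic \<Rightarrow> 'p padic) \<Rightarrow> 'p padic \<Rightarrow> 'p padic \<Rightarrow> 'p padic" where
  "diff_quot \<phi> y z = (if y = z then padic_deriv \<phi> y else (\<phi> y - \<phi> z) / (y - z))"

definition mixed_deriv_diag ::
  "('p::prime_card padic \<Rightarrow> 'p padic \<Rightarrow> 'p padic) \<Rightarrow> 'p padic \<Rightarrow> 'p padic" where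
  "mixed_deriv_diag V x = padic_deriv (\<lambda>y. padic_deriv (\<lambda>z. V y z) x) x"

definition schwarzian_potential ::
  "('p::prime_card padic \<Rightarrow> 'p padic) \<Rightarrow> 'p padic \<Rightarrow> 'p padic \<Rightarrow> 'p padic" where
  "schwarzian_potential \<phi> y z = padic_log (diff_quot \<phi> y z)"

definition schwarzian :: "('p::prime_card padic \<Rightarrow> 'p padic) \<Rightarrow> 'p padic \<Rightarrow> 'p padic" where
  "schwarzian \<phi> x = 6 * mixed_deriv_diag (schwarzian_potential \<phi>) x"

definition frobenius_potential ::
  "nat \<Rightarrow> ('p::prime_card padic \<Rightarrow> 'p padic) \<Rightarrow> 'p padic \<Rightarrow> 'p padic \<Rightarrow> 'p padic" where
  "frobenius_potential m \<phi> y z =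
     1 / of_nat (CARD('p) ^ m) * (diff_quot \<phi> y z ^ (CARD('p) ^ m) - 1)"

definition frobenius_schwarzian ::
  "nat \<Rightarrow> ('p::prime_card padic \<Rightarrow> 'p padic) \<Rightarrow> 'p padic \<Rightarrow> 'p padic" where
  "frobenius_schwarzian m \<phi> x = 6 * mixed_deriv_diag (frobenius_potential m \<phi>) x"

end

theory Submission
  imports Defs
begin

text \<open>
  Let \<open>c n\<close> be the coefficients of the expansion of \<open>\<phi>\<close> about \<open>x\<close>, so that the first two
  derivatives of \<open>\<phi>\<close> at \<open>x\<close> are \<open>c 1\<close> and \<open>2 * c 2\<close>. The difference quotient \<open>Q y z\<close> has at
  \<open>(x, x)\<close> the value \<open>c 1\<close>, both partial derivatives \<open>c 2\<close> and mixed derivative \<open>c 3\<close>. Hence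
  the mixed derivative of \<open>F (Q y z)\<close> at \<open>(x, x)\<close> is \<open>F'' (c 1) * c 2 ^ 2 + F' (c 1) * c 3\<close>
  for every twice differentiable \<open>F\<close> (lemma \<open>mixed_deriv_diag_diff_quot\<close>). For
  \<open>F = log\<close> and for \<open>F w = (w ^ N - 1) / N\<close> with \<open>N = p ^ m\<close> this expresses the two Schwarzians
  through \<open>c 1\<close>, \<open>c 2\<close>, \<open>c 3\<close> (lemma \<open>schwarzian_power_series\<close>), and the stated identity is
  algebra.

  The Lipschitz condition puts every difference quotient, including its diagonal values, in the open
  unit disc about 1 (lemma \<open>Diff_an_diff_quot\<close>). There the logarithm converges and is
  differentiable, and there \<open>w ^ (p ^ m)\<close> tends to 1 (lemma \<open>power_prime_power_tendsto_1\<close>). As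
  \<open>p ^ m\<close> tends to 0, the identity yields the limit.

  The analytic input is that a convergent p-adic power series can be differentiated term by term
  (lemma \<open>has_power_series_deriv\<close>), which follows from the ultrametric inequality.
\<close>

section \<open>The topological field of p-adic numbers\<close>

lemma padic_abs_0 [simp]: "padic_abs 0 = 0"
  by simp

lemma padic_abs_1 [simp]: "padic_abs (1 :: 'p::prime_card padic) = 1"
proof -
  have "padic_abs (1 :: 'p padic) * padic_abs (1 :: 'p padic) = padic_abs (1 :: 'p padic) * 1"
    by (metis padic_abs_mult mult_1_right)
  then show ?thesis
    by (metis mult_cancel_left padic_abs_eq_0_iff zero_neq_one)
qed

lemma padic_abs_power: "padic_abs (x ^ n) = padic_abs x ^ n"
  by (induction n) (simp_all add: padic_abs_mult)

lemma padic_abs_inverse: "padic_abs (inverse x) = inverse (padic_abs x)"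
proof (cases "x = 0")
  case False
  then have "padic_abs (inverse x) * padic_abs x = 1"
    by (simp flip: padic_abs_mult)
  then show ?thesis
    by (metis inverse_unique mult.commute)
qed simp

lemma padic_abs_divide: "padic_abs (x / y) = padic_abs x / padic_abs y"
  by (simp add: divide_inverse padic_abs_mult padic_abs_inverse)

lemma padic_abs_diff_commute: "padic_abs (x - y) = padic_abs (y - x)"
  using padic_abs_minus[of "x - y"] by simp

lemma padic_abs_add_le: "padic_abs x \<le> C \<Longrightarrow> padic_abs y \<le> C \<Longrightarrow> padic_abs (x + y) \<le> C"
  using padic_abs_add[of x y] by simp

lemma padic_abs_add_less: "padic_abs x < C \<Longrightarrow> padic_abs y < C \<Longrightarrow> padic_abs (x + y) < C"
  using padic_abs_add[of x y] by simp

lemma padic_abs_diff_less: "padic_abs x < C \<Longrightarrow> padic_abs y < C \<Longrightarrow> padic_abs (x - y) < C"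
  using padic_abs_add_less[of x C "- y"] by simp

lemma padic_abs_sum_le:
  assumes "0 \<le> C" "\<And>i. i \<in> I \<Longrightarrow> padic_abs (f i) \<le> C"
  shows "padic_abs (\<Sum>i\<in>I. f i) \<le> C"
  using assms(2)
  by (induction I rule: infinite_finite_induct) (auto intro: padic_abs_add_le assms(1))

lemma padic_abs_of_nat_le_1: "padic_abs (of_nat n) \<le> 1"
  by (induction n) (auto intro: padic_abs_add_le)

text \<open>
  If \<open>p ^ v\<close> is the power of \<open>p\<close> in \<open>n\<close>, then the absolute value of \<open>n\<close> is \<open>1 / p ^ v\<close> and
  \<open>p ^ v \<le> n\<close>. So dividing by \<open>n\<close> in the logarithm series enlarges a term by
  a factor of at most \<open>n\<close>.
\<close>

lemma padic_abs_of_nat_ge: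
  assumes "n > 0"
  shows "1 / real n \<le> padic_abs (of_nat n :: 'p::prime_card padic)"
proof -
  let ?p = "CARD('p)"
  have p: "prime ?p" by (rule prime_card)
  define v where "v = multiplicity (int ?p) (int n)"
  have "int ?p ^ v dvd int n"
    unfolding v_def by (rule multiplicity_dvd)
  then have "?p ^ v dvd n"
    by (metis int_dvd_int_iff of_nat_power)
  then have le: "?p ^ v \<le> n"
    using assms by (simp add: dvd_imp_le)
  have "padic_abs (of_nat n :: 'p padic) = rat_padic_abs ?p (of_int (int n) / of_int 1)"
    using padic_abs_of_rat[where 'p = 'p, of "of_nat n"] by simp
  also have "\<dots> = real ?p powi (- int v)"
    using assms by (subst rat_padic_abs_divide[OF p]) (auto simp: v_def)
  also have "\<dots> = 1 / real (?p ^ v)"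
    by (simp add: power_int_minus divide_inverse)
  also have "1 / real n \<le> 1 / real (?p ^ v)"
    using le p assms by (intro divide_left_mono) (auto simp: prime_gt_0_nat simp del: of_nat_power)
  finally show ?thesis by simp
qed

lemma padic_abs_of_prime:
  "padic_abs (of_nat CARD('p) :: 'p::prime_card padic) = 1 / real CARD('p)"
proof -
  let ?p = "CARD('p)"
  have p: "prime ?p" by (rule prime_card)
  have "padic_abs (of_nat ?p :: 'p padic) = rat_padic_abs ?p (of_int (int ?p) / of_int 1)"
    using padic_abs_of_rat[where 'p = 'p, of "of_nat ?p"] by simp
  also have "\<dots> = real ?p powi (- 1)"
    using p by (subst rat_padic_abs_divide[OF p]) auto
  finally show ?thesis by (simp add: power_int_minus divide_inverse)
qed

lemma tendsto_padic_iff: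
  fixes f :: "'a \<Rightarrow> 'p::prime_card padic"
  shows "(f \<longlongrightarrow> l) F \<longleftrightarrow> ((\<lambda>x. padic_abs (f x - l)) \<longlongrightarrow> 0) F"
  by (subst tendsto_dist_iff) (simp add: dist_padic_def)

instance padic :: (prime_card) topological_ab_group_add
proof
  fix a b :: "'a padic"
  let ?F = "nhds a \<times>\<^sub>F nhds b"
  let ?h = "\<lambda>u. padic_abs (fst u - a) + padic_abs (snd u - b)"
  have h: "(?h \<longlongrightarrow> 0 + 0) ?F"
    unfolding nhds_prod[symmetric]
    by (intro tendsto_add)
       (simp_all add: tendsto_padic_iff[symmetric] tendsto_fst[OF filterlim_ident, of "(a,b)", simplified]
          tendsto_snd[OF filterlim_ident, of "(a,b)", simplified])
  have le: "padic_abs (fst u + snd u - (a + b)) \<le> ?h u" for u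
    using padic_abs_add[of "fst u - a" "snd u - b"] padic_abs_ge_0[of "fst u - a"]
      padic_abs_ge_0[of "snd u - b"] unfolding add_diff_add by linarith
  show "LIM u ?F. fst u + snd u :> nhds (a + b)"
    unfolding tendsto_padic_iff
  proof (rule tendsto_sandwich[OF _ _ tendsto_const])
    show "(?h \<longlongrightarrow> 0) ?F" using h by simp
    show "\<forall>\<^sub>F u in ?F. padic_abs (fst u + snd u - (a + b)) \<le> ?h u"
      by (intro always_eventually allI le)
  qed simp
  have "padic_abs (- x - - a) = padic_abs (x - a)" for x
    using padic_abs_minus[of "x - a"] by simp
  then show "(uminus \<longlongrightarrow> - a) (nhds a)"
    using filterlim_ident[of "nhds a"] by (simp add: tendsto_padic_iff)
qed

instance padic :: (prime_card) topological_semigroup_mult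
proof
  fix a b :: "'a padic"
  let ?F = "nhds a \<times>\<^sub>F nhds b"
  let ?h = "\<lambda>u. padic_abs (fst u - a) * padic_abs (snd u - b) + padic_abs (fst u - a) * padic_abs b
     + padic_abs a * padic_abs (snd u - b)"
  have f: "((\<lambda>u. padic_abs (fst u - a)) \<longlongrightarrow> 0) ?F" and s: "((\<lambda>u. padic_abs (snd u - b)) \<longlongrightarrow> 0) ?F"
    unfolding nhds_prod[symmetric]
    by (simp_all add: tendsto_padic_iff[symmetric] tendsto_fst[OF filterlim_ident, of "(a,b)", simplified]
          tendsto_snd[OF filterlim_ident, of "(a,b)", simplified])
  have h: "(?h \<longlongrightarrow> 0 * 0 + 0 * padic_abs b + padic_abs a * 0) ?F"
    by (intro tendsto_intros f s)
  have le: "padic_abs (fst u * snd u - a * b) \<le> ?h u" for u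
  proof -
    have "fst u * snd u - a * b = (fst u - a) * (snd u - b) + ((fst u - a) * b + a * (snd u - b))"
      by (simp add: algebra_simps)
    also have "padic_abs \<dots> \<le> max (padic_abs ((fst u - a) * (snd u - b)))
        (max (padic_abs ((fst u - a) * b)) (padic_abs (a * (snd u - b))))"
      by (meson padic_abs_add max.mono order_refl order_trans)
    also have "\<dots> \<le> ?h u"
      using padic_abs_ge_0 by (intro max.boundedI) (simp_all only: padic_abs_mult, simp_all)
    finally show ?thesis .
  qed
  show "LIM u ?F. fst u * snd u :> nhds (a * b)"
    unfolding tendsto_padic_iff
  proof (rule tendsto_sandwich[OF _ _ tendsto_const])
    show "(?h \<longlongrightarrow> 0) ?F" using h by simp
    show "\<forall>\<^sub>F u in ?F. padic_abs (fst u * snd u - a * b) \<le> ?h u"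
      by (intro always_eventually allI le)
  qed simp
qed

lemma tendsto_inverse_padic:
  fixes f :: "'a \<Rightarrow> 'p::prime_card padic"
  assumes f: "(f \<longlongrightarrow> a) F" and a: "a \<noteq> 0"
  shows "((\<lambda>x. inverse (f x)) \<longlongrightarrow> inverse a) F"
  unfolding tendsto_padic_iff
proof (rule tendsto_sandwich[OF _ _ tendsto_const])
  let ?d = "\<lambda>x. padic_abs (f x - a)"
  have d: "(?d \<longlongrightarrow> 0) F" using f by (simp add: tendsto_padic_iff)
  have "\<forall>\<^sub>F x in F. ?d x < padic_abs a"
    using order_tendstoD(2)[OF d, of "padic_abs a"] a by (simp add: less_le)
  then show "\<forall>\<^sub>F x in F. padic_abs (inverse (f x) - inverse a) \<le> ?d x / (padic_abs a * padic_abs a)"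
  proof eventually_elim
    case (elim x)
    \<comment> \<open>Within distance less than \<open>padic_abs a\<close> of \<open>a\<close> the absolute value is constant.\<close>
    have "padic_abs a \<le> padic_abs (f x)"
      using padic_abs_add[of "f x" "a - f x"] elim by (simp add: padic_abs_diff_commute)
    moreover have "padic_abs a > 0" using a by (simp add: less_le)
    ultimately have pos: "padic_abs a > 0" "padic_abs (f x) > 0" "padic_abs a \<le> padic_abs (f x)" by linarith+
    then have nz: "f x \<noteq> 0" by auto
    have "padic_abs (inverse (f x) - inverse a) = ?d x * inverse (padic_abs (f x)) * inverse (padic_abs a)"
      using nz a inverse_diff_inverse[of "f x" a]
        padic_abs_minus[of "inverse (f x) * (f x - a) * inverse a"]
      by (simp add: padic_abs_mult padic_abs_inverse)
    also have "\<dots> \<le> ?d x * inverse (padic_abs a) * inverse (padic_abs a)"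
      using pos by (intro mult_right_mono mult_left_mono le_imp_inverse_le) auto
    finally show ?case by (simp add: divide_inverse mult.assoc)
  qed
  show "((\<lambda>x. ?d x / (padic_abs a * padic_abs a)) \<longlongrightarrow> 0) F"
    using tendsto_divide[OF d tendsto_const[of "padic_abs a * padic_abs a"]] a by simp
qed simp

lemma of_nat_prime_power_tendsto_0:
  "(\<lambda>m. of_nat (CARD('p) ^ m) :: 'p::prime_card padic) \<longlonglongrightarrow> 0"
proof -
  have "(\<lambda>m. (1 / real CARD('p)) ^ m) \<longlonglongrightarrow> 0"
    using prime_gt_1_nat[OF prime_card[where 'a = 'p]] by (intro LIMSEQ_power_zero) auto
  then show ?thesis
    by (simp add: tendsto_padic_iff padic_abs_power padic_abs_of_prime)
qed

lemma ex_small_padic: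
  assumes "r > 0"
  obtains s :: "'p::prime_card padic" where "s \<noteq> 0" "padic_abs s < r"
proof -
  have "\<forall>\<^sub>F m in sequentially. padic_abs (of_nat (CARD('p) ^ m) - 0 :: 'p padic) < r"
    using order_tendstoD(2)[OF of_nat_prime_power_tendsto_0[where 'p = 'p, unfolded tendsto_padic_iff] assms] .
  then obtain m where "padic_abs (of_nat (CARD('p) ^ m) :: 'p padic) < r"
    by (auto simp: eventually_sequentially)
  moreover have "(of_nat (CARD('p) ^ m) :: 'p padic) \<noteq> 0"
    by simp
  ultimately show thesis by (rule that[rotated])
qed

instance padic :: (prime_card) perfect_space
proof
  fix x :: "'a padic"
  show "\<not> open {x}"
  proof
    assume "open {x}"
    then obtain e where e: "e > 0" "\<And>y. dist y x < e \<Longrightarrow> y = x"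
      unfolding open_dist by auto
    obtain s :: "'a padic" where "s \<noteq> 0" "padic_abs s < e"
      using ex_small_padic[OF e(1)] .
    then show False
      using e(2)[of "x + s"] by (simp add: dist_padic_def)
  qed
qed

lemma eventually_nhds_padic:
  "(\<forall>\<^sub>F y in nhds x. P y) \<longleftrightarrow> (\<exists>r>0. \<forall>y. padic_abs (y - x) < r \<longrightarrow> P y)"
  by (simp add: eventually_nhds_metric dist_padic_def)

section \<open>Derivatives\<close>

text \<open>
  The function \<open>padic_deriv\<close> returns a value even where no derivative exists; the relation below
  also records existence, which the rules of calculus need.
\<close>

definition has_padic_deriv ::
  "('p::prime_card padic \<Rightarrow> 'p padic) \<Rightarrow> 'p padic \<Rightarrow> 'p padic \<Rightarrow> bool" where
  "has_padic_deriv f d x \<longleftrightarrow> ((\<lambda>y. (f y - f x) / (y - x)) \<longlongrightarrow> d) (at x)"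

lemma has_padic_deriv_imp_deriv: "has_padic_deriv f d x \<Longrightarrow> padic_deriv f x = d"
  unfolding has_padic_deriv_def padic_deriv_def by (rule tendsto_Lim) simp

text \<open>
  Caratheodory's description of the derivative removes the division, so that the product and
  chain rules become algebra with continuous functions.
\<close>

lemma has_padic_deriv_caratheodory:
  "has_padic_deriv f d x \<longleftrightarrow>
     (\<exists>g. (\<forall>y. f y = f x + g y * (y - x)) \<and> g x = d \<and> (g \<longlongrightarrow> d) (nhds x))"
proof
  assume f: "has_padic_deriv f d x"
  define g where "g y = (if y = x then d else (f y - f x) / (y - x))" for y
  have "(g \<longlongrightarrow> g x) (at x)"
  proof (rule Lim_transform_eventually)
    show "((\<lambda>y. (f y - f x) / (y - x)) \<longlongrightarrow> g x) (at x)"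
      using f by (simp add: has_padic_deriv_def g_def)
  qed (simp add: g_def eventually_at_filter)
  then have "(g \<longlongrightarrow> g x) (nhds x)"
    by (simp add: tendsto_at_iff_tendsto_nhds)
  then show "\<exists>g. (\<forall>y. f y = f x + g y * (y - x)) \<and> g x = d \<and> (g \<longlongrightarrow> d) (nhds x)"
    by (intro exI[of _ g]) (auto simp: g_def)
next
  assume "\<exists>g. (\<forall>y. f y = f x + g y * (y - x)) \<and> g x = d \<and> (g \<longlongrightarrow> d) (nhds x)"
  then obtain g where g: "\<And>y. f y = f x + g y * (y - x)" "(g \<longlongrightarrow> d) (nhds x)"
    by blast
  have "(g \<longlongrightarrow> d) (at x)"
    using g(2) filterlim_at_within_not_equal tendsto_mono[OF at_within_le_nhds] by blast
  then show "has_padic_deriv f d x"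
    unfolding has_padic_deriv_def
  proof (rule Lim_transform_eventually)
    have "g y = (f y - f x) / (y - x)" if "y \<noteq> x" for y
      using g(1)[of y] that by simp
    then show "\<forall>\<^sub>F y in at x. g y = (f y - f x) / (y - x)"
      by (simp add: eventually_at_filter)
  qed
qed

lemma has_padic_derivI:
  assumes "(g \<longlongrightarrow> d) (nhds x)" "\<And>y. f y = f x + g y * (y - x)" "g x = d"
  shows "has_padic_deriv f d x"
  unfolding has_padic_deriv_caratheodory by (intro exI[of _ g] conjI allI assms)

lemma has_padic_deriv_tendsto:
  assumes "has_padic_deriv f d x" shows "(f \<longlongrightarrow> f x) (nhds x)"
proof -
  from assms obtain g where g: "\<forall>y. f y = f x + g y * (y - x)" "g x = d" "(g \<longlongrightarrow> d) (nhds x)"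
    unfolding has_padic_deriv_caratheodory by (elim exE conjE)
  have "((\<lambda>y. f x + g y * (y - x)) \<longlongrightarrow> f x + d * 0) (nhds x)"
    using filterlim_ident[of "nhds x"]
    by (intro tendsto_add tendsto_const tendsto_mult g(3)) (simp add: tendsto_padic_iff)
  moreover have "(\<lambda>y. f x + g y * (y - x)) = f"
    using g(1) by (intro ext) (rule sym, rule spec)
  ultimately show ?thesis by simp
qed

lemma has_padic_deriv_cong:
  assumes "has_padic_deriv f d x" "\<forall>\<^sub>F y in nhds x. g y = f y"
  shows "has_padic_deriv g d x"
  using assms(1) unfolding has_padic_deriv_def
proof (rule Lim_transform_eventually)
  have "g x = f x" using assms(2) by (rule eventually_nhds_x_imp_x)
  with assms(2) show "\<forall>\<^sub>F y in at x. (f y - f x) / (y - x) = (g y - g x) / (y - x)"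
    unfolding eventually_at_filter by (elim eventually_mono) simp
qed

lemma has_padic_deriv_const: "has_padic_deriv (\<lambda>y. c) 0 x"
  by (simp add: has_padic_deriv_def)

lemma has_padic_deriv_ident: "has_padic_deriv (\<lambda>y. y) 1 x"
  by (rule has_padic_derivI[where g = "\<lambda>_. 1"]) simp_all

lemma has_padic_deriv_diff:
  assumes "has_padic_deriv f d x" "has_padic_deriv g e x"
  shows "has_padic_deriv (\<lambda>y. f y - g y) (d - e) x"
proof -
  from assms(1) obtain u where u: "\<forall>y. f y = f x + u y * (y - x)" "u x = d" "(u \<longlongrightarrow> d) (nhds x)"
    unfolding has_padic_deriv_caratheodory by (elim exE conjE)
  from assms(2) obtain v where v: "\<forall>y. g y = g x + v y * (y - x)" "v x = e" "(v \<longlongrightarrow> e) (nhds x)"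
    unfolding has_padic_deriv_caratheodory by (elim exE conjE)
  have "((\<lambda>y. u y - v y) \<longlongrightarrow> d - e) (nhds x)"
    by (intro tendsto_intros u v)
  moreover have "f y - g y = f x - g x + (u y - v y) * (y - x)" for y
  proof -
    have "f y - g y = (f x + u y * (y - x)) - (g x + v y * (y - x))"
      by (rule arg_cong2[where f = minus, OF spec[OF u(1)] spec[OF v(1)]])
    also have "\<dots> = f x - g x + (u y - v y) * (y - x)"
      by (simp add: algebra_simps)
    finally show ?thesis .
  qed
  ultimately show ?thesis
    by (rule has_padic_derivI) (simp_all only: u(2) v(2))
qed

lemma has_padic_deriv_mult:
  assumes "has_padic_deriv f d x" "has_padic_deriv g e x"
  shows "has_padic_deriv (\<lambda>y. f y * g y) (d * g x + f x * e) x"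
proof -
  from assms(1) obtain u where u: "\<forall>y. f y = f x + u y * (y - x)" "u x = d" "(u \<longlongrightarrow> d) (nhds x)"
    unfolding has_padic_deriv_caratheodory by (elim exE conjE)
  from assms(2) obtain v where v: "\<forall>y. g y = g x + v y * (y - x)" "v x = e" "(v \<longlongrightarrow> e) (nhds x)"
    unfolding has_padic_deriv_caratheodory by (elim exE conjE)
  have "((\<lambda>y. u y * g y + f x * v y) \<longlongrightarrow> d * g x + f x * e) (nhds x)"
    by (intro tendsto_intros u v has_padic_deriv_tendsto[OF assms(2)])
  moreover have "f y * g y = f x * g x + (u y * g y + f x * v y) * (y - x)" for y
  proof -
    have fy: "f y - f x = u y * (y - x)"
      by (subst spec[OF u(1), of y]) (rule add_diff_cancel_left')
    have "f x * g x + (u y * g y + f x * v y) * (y - x)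
        = f x * (g x + v y * (y - x)) + (u y * (y - x)) * g y"
      by (simp only: algebra_simps)
    also have "\<dots> = f x * g y + (f y - f x) * g y"
      by (simp only: fy spec[OF v(1), of y, symmetric])
    also have "\<dots> = f y * g y"
      by (simp add: algebra_simps)
    finally show ?thesis by (rule sym)
  qed
  ultimately show ?thesis
    by (rule has_padic_derivI) (simp_all only: u(2) v(2))
qed

lemma has_padic_deriv_chain:
  assumes "has_padic_deriv f d x" "has_padic_deriv F e (f x)"
  shows "has_padic_deriv (\<lambda>y. F (f y)) (e * d) x"
proof -
  from assms(1) obtain u where u: "\<forall>y. f y = f x + u y * (y - x)" "u x = d" "(u \<longlongrightarrow> d) (nhds x)"
    unfolding has_padic_deriv_caratheodory by (elim exE conjE)
  from assms(2) obtain v where v: "\<forall>y. F y = F (f x) + v y * (y - f x)" "v (f x) = e" "(v \<longlongrightarrow> e) (nhds (f x))"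
    unfolding has_padic_deriv_caratheodory by (elim exE conjE)
  have "((\<lambda>y. v (f y) * u y) \<longlongrightarrow> e * d) (nhds x)"
    by (intro tendsto_mult u filterlim_compose[OF v(3)] has_padic_deriv_tendsto[OF assms(1)])
  moreover have "F (f y) = F (f x) + v (f y) * u y * (y - x)" for y
  proof -
    have fy: "f y - f x = u y * (y - x)"
      by (subst spec[OF u(1), of y]) (rule add_diff_cancel_left')
    have "F (f y) = F (f x) + v (f y) * (f y - f x)"
      by (rule spec[OF v(1)])
    then show ?thesis by (simp only: fy mult.assoc)
  qed
  ultimately show ?thesis
    by (rule has_padic_derivI) (simp_all only: u(2) v(2))
qed

lemma has_padic_deriv_inverse:
  assumes "w \<noteq> 0"
  shows "has_padic_deriv inverse (- (1 / w ^ 2)) w"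
  unfolding has_padic_deriv_def
proof (rule Lim_transform_eventually)
  have "((\<lambda>y. inverse y) \<longlongrightarrow> inverse w) (at w)"
    using assms by (intro tendsto_inverse_padic) simp_all
  then show "((\<lambda>y. - (inverse y * inverse w)) \<longlongrightarrow> - (1 / w ^ 2)) (at w)"
    using tendsto_minus[OF tendsto_mult_right[of inverse "inverse w" "at w" "inverse w"]]
    by (simp add: divide_inverse power2_eq_square)
  have "\<forall>\<^sub>F y in nhds w. y \<noteq> 0"
    using assms by (rule t1_space_nhds)
  then have "\<forall>\<^sub>F y in at w. y \<noteq> 0"
    unfolding eventually_at_filter by (rule eventually_mono) simp
  moreover have "\<forall>\<^sub>F y in at w. y \<noteq> w"
    by (simp add: eventually_at_filter)
  ultimately show "\<forall>\<^sub>F y in at w. - (inverse y * inverse w) = (inverse y - inverse w) / (y - w)"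
  proof eventually_elim
    case (elim y)
    then show ?case using assms by (simp add: divide_simps)
  qed
qed

text \<open>
  The derivative is written with \<open>w ^ n / w\<close> instead of \<open>w ^ (n - 1)\<close> so that no truncated
  exponent occurs, in particular not in second derivatives.
\<close>

lemma has_padic_deriv_power:
  assumes "w \<noteq> 0"
  shows "has_padic_deriv (\<lambda>w. w ^ n) (of_nat n * w ^ n / w) w"
proof (induction n)
  case 0
  then show ?case using has_padic_deriv_const[of 1 w] by simp
next
  case (Suc n)
  have "1 * w ^ n + w * (of_nat n * w ^ n / w) = of_nat (Suc n) * w ^ Suc n / w"
    using assms by (simp add: field_simps)
  then show ?case
    using has_padic_deriv_mult[OF has_padic_deriv_ident Suc] by simp
qed

section \<open>Power series\<close>

lemma sums_mult_padic:
  fixes f :: "nat \<Rightarrow> 'p::prime_card padic"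
  assumes "f sums s" shows "(\<lambda>n. c * f n) sums (c * s)"
  using tendsto_mult_left[OF assms[unfolded sums_def], of c]
  by (simp add: sums_def sum_distrib_left)

lemma sums_diff_padic:
  fixes f g :: "nat \<Rightarrow> 'p::prime_card padic"
  assumes "f sums s" "g sums t" shows "(\<lambda>n. f n - g n) sums (s - t)"
  using tendsto_diff[OF assms[unfolded sums_def]] by (simp add: sums_def sum_subtractf)

lemma sums_shift_padic:
  fixes f :: "nat \<Rightarrow> 'p::prime_card padic"
  assumes "f sums s" shows "(\<lambda>n. f (Suc n)) sums (s - f 0)"
proof -
  have "(\<lambda>n. (\<Sum>i<Suc n. f i) - f 0) \<longlonglongrightarrow> s - f 0"
    using assms unfolding sums_def by (intro tendsto_diff tendsto_const LIMSEQ_Suc)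
  then show ?thesis
    by (simp only: sums_def sum.lessThan_Suc_shift add_diff_cancel_left')
qed

lemma sums_imp_null_padic:
  fixes f :: "nat \<Rightarrow> 'p::prime_card padic"
  assumes "f sums s" shows "f \<longlonglongrightarrow> 0"
  using tendsto_diff[OF LIMSEQ_Suc[OF assms[unfolded sums_def]] assms[unfolded sums_def]] by simp

text \<open>
  By the ultrametric inequality a tail of a series is no larger than its largest term, so terms
  tending to zero already make the partial sums a Cauchy sequence.
\<close>

lemma summable_padic:
  fixes f :: "nat \<Rightarrow> 'p::prime_card padic"
  assumes "f \<longlonglongrightarrow> 0" shows "summable f"
proof -
  have "Cauchy (\<lambda>n. \<Sum>i<n. f i)"
  proof (rule metric_CauchyI)
    fix e :: real assume e: "e > 0"
    have "(\<lambda>n. padic_abs (f n)) \<longlonglongrightarrow> 0"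
      using assms by (simp add: tendsto_padic_iff)
    then have "\<forall>\<^sub>F n in sequentially. padic_abs (f n) < e / 2"
      using e by (intro order_tendstoD(2)) auto
    then obtain N where N: "\<And>n. n \<ge> N \<Longrightarrow> padic_abs (f n) < e / 2"
      unfolding eventually_sequentially by blast
    have N_sum: "padic_abs ((\<Sum>i<n. f i) - (\<Sum>i<N. f i)) \<le> e / 2" if "n \<ge> N" for n
    proof -
      have "(\<Sum>i<n. f i) - (\<Sum>i<N. f i) = (\<Sum>i\<in>{N..<n}. f i)"
        using sum_diff_nat_ivl[of 0 N n f] that by (simp add: atLeast0LessThan)
      moreover have "padic_abs (\<Sum>i\<in>{N..<n}. f i) \<le> e / 2"
        using e N by (intro padic_abs_sum_le) (simp_all add: less_imp_le)
      ultimately show ?thesis by simp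
    qed
    have "dist (\<Sum>i<m. f i) (\<Sum>i<n. f i) < e" if "m \<ge> N" "n \<ge> N" for m n
    proof -
      have "dist (\<Sum>i<m. f i) (\<Sum>i<n. f i)
          = padic_abs (((\<Sum>i<m. f i) - (\<Sum>i<N. f i)) + ((\<Sum>i<N. f i) - (\<Sum>i<n. f i)))"
        by (simp add: dist_padic_def)
      also have "\<dots> \<le> e / 2"
        using N_sum[OF that(1)] N_sum[OF that(2)]
        by (intro padic_abs_add_le) (simp_all add: padic_abs_diff_commute)
      finally show ?thesis using e by simp
    qed
    then show "\<exists>M. \<forall>m\<ge>M. \<forall>n\<ge>M. dist (\<Sum>i<m. f i) (\<Sum>i<n. f i) < e"
      by blast
  qed
  then show ?thesis
    by (simp add: summable_iff_convergent Cauchy_convergent)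
qed

lemma sums_padic_abs_le:
  fixes f :: "nat \<Rightarrow> 'p::prime_card padic"
  assumes "f sums s" "\<And>n. padic_abs (f n) \<le> C"
  shows "padic_abs s \<le> C"
proof (rule LIMSEQ_le_const2)
  have "(\<lambda>n. dist (\<Sum>i<n. f i) 0) \<longlonglongrightarrow> dist s 0"
    using assms(1) unfolding sums_def by (intro tendsto_dist tendsto_const)
  then show "(\<lambda>n. padic_abs (\<Sum>i<n. f i)) \<longlonglongrightarrow> padic_abs s"
    by (simp add: dist_padic_def)
  have "0 \<le> C" using assms(2)[of 0] padic_abs_ge_0[of "f 0"] by linarith
  then show "\<exists>N. \<forall>n\<ge>N. padic_abs (\<Sum>i<n. f i) \<le> C"
    using assms(2) by (intro exI[of _ 0] allI impI padic_abs_sum_le)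
qed

text \<open>
  Expansions are always centred at 0; the expansion of \<open>\<phi>\<close> about \<open>x\<close> is that of
  \<open>\<lambda>h. \<phi> (x + h)\<close>. This lets index shifts act on functions of \<open>h\<close> alone.
\<close>

definition has_power_series ::
  "('p::prime_card padic \<Rightarrow> 'p padic) \<Rightarrow> (nat \<Rightarrow> 'p padic) \<Rightarrow> real \<Rightarrow> bool" where
  "has_power_series f a r \<longleftrightarrow> (\<forall>t. padic_abs t < r \<longrightarrow> (\<lambda>n. a n * t ^ n) sums f t)"

lemma has_power_series_at_0:
  fixes f :: "'p::prime_card padic \<Rightarrow> 'p padic"
  assumes "has_power_series f a r" "r > 0"
  shows "f 0 = a 0"
proof -
  have "(\<lambda>n. a n * 0 ^ n) sums f 0"
    using assms by (simp add: has_power_series_def)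
  moreover have "(\<lambda>n. a n * 0 ^ n) = (\<lambda>n. if n = 0 then a n else 0)"
    by (rule ext) (simp add: power_0_left)
  moreover have "(\<lambda>n. if n = 0 then a n else 0) sums a 0"
    by (rule sums_single)
  ultimately show ?thesis
    using sums_unique2 by metis
qed

text \<open>
  Removing the constant term and dividing by \<open>t\<close> shifts the coefficients. Done once, it turns
  \<open>\<phi>\<close> into its difference quotient; done twice, it gives the derivative of the difference
  quotient in its other variable.
\<close>

lemma has_power_series_shift:
  fixes f :: "'p::prime_card padic \<Rightarrow> 'p padic"
  assumes f: "has_power_series f a r" and r: "r > 0"
  shows "has_power_series (\<lambda>t. if t = 0 then a 1 else (f t - a 0) / t) (\<lambda>n. a (Suc n)) r"
  unfolding has_power_series_def
proof (intro allI impI)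
  fix t :: "'p padic" assume t: "padic_abs t < r"
  show "(\<lambda>n. a (Suc n) * t ^ n) sums (if t = 0 then a 1 else (f t - a 0) / t)"
  proof (cases "t = 0")
    case True
    have "(\<lambda>n. a (Suc n) * 0 ^ n) = (\<lambda>n. if n = 0 then a (Suc n) else 0)"
      by (rule ext) (simp add: power_0_left)
    moreover have "(\<lambda>n. if n = 0 then a (Suc n) else 0) sums a (Suc 0)"
      by (rule sums_single)
    ultimately show ?thesis using True by simp
  next
    case False
    have "(\<lambda>n. a n * t ^ n) sums f t"
      using f t by (simp add: has_power_series_def)
    from sums_mult_padic[OF sums_shift_padic[OF this], of "inverse t"]
    have "(\<lambda>n. inverse t * (a (Suc n) * t ^ Suc n)) sums (inverse t * (f t - a 0))"
      by simp
    moreover have "(\<lambda>n. inverse t * (a (Suc n) * t ^ Suc n)) = (\<lambda>n. a (Suc n) * t ^ n)"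
      using False by (intro ext) (simp add: field_simps)
    moreover have "inverse t * (f t - a 0) = (f t - a 0) / t"
      by (simp add: divide_inverse mult.commute)
    ultimately show ?thesis
      using False by simp
  qed
qed

text \<open>
  The remainder is \<open>k ^ 2\<close> times a polynomial in \<open>t\<close> and \<open>k\<close> with integer coefficients, homogeneous
  of degree \<open>n - 2\<close>, and integers have absolute value at most 1. Multiplying by \<open>S ^ 2\<close> avoids the
  exponent \<open>n - 2\<close>.
\<close>

lemma power_remainder_bound:
  fixes t k s :: "'p::prime_card padic"
  assumes t: "padic_abs t \<le> S" and k: "padic_abs k \<le> S"
  shows "padic_abs ((t + k) ^ n - t ^ n - of_nat n * t ^ (n - 1) * k) * S ^ 2 \<le> padic_abs k ^ 2 * S ^ n"
proof (induction n)
  case (Suc n)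
  define D where "D = (t + k) ^ n - t ^ n - of_nat n * t ^ (n - 1) * k"
  have S: "S \<ge> 0" using k padic_abs_ge_0[of k] by linarith
  have "(t + k) ^ Suc n - t ^ Suc n - of_nat (Suc n) * t ^ (Suc n - 1) * k
      = (t + k) * D + of_nat n * t ^ (n - 1) * k ^ 2"
    by (cases n) (simp_all add: D_def algebra_simps power2_eq_square)
  moreover have "padic_abs ((t + k) * D + of_nat n * t ^ (n - 1) * k ^ 2) * S ^ 2
      \<le> padic_abs k ^ 2 * S ^ Suc n"
  proof -
    have "padic_abs ((t + k) * D) * S ^ 2 \<le> S * (padic_abs D * S ^ 2)"
      using padic_abs_add_le[OF t k] S
      by (simp add: padic_abs_mult mult.assoc mult_right_mono)
    also have "\<dots> \<le> S * (padic_abs k ^ 2 * S ^ n)"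
      using Suc.IH S unfolding D_def by (rule mult_left_mono)
    finally have 1: "padic_abs ((t + k) * D) * S ^ 2 \<le> padic_abs k ^ 2 * S ^ Suc n"
      by (simp add: ac_simps)
    have 2: "padic_abs (of_nat n * t ^ (n - 1) * k ^ 2) * S ^ 2 \<le> padic_abs k ^ 2 * S ^ Suc n"
    proof (cases n)
      case 0
      then show ?thesis using S by simp
    next
      case n: (Suc l)
      have "padic_abs (of_nat n * t ^ (n - 1)) \<le> 1 * S ^ l"
        unfolding padic_abs_mult padic_abs_power n diff_Suc_1
        by (intro mult_mono power_mono t padic_abs_of_nat_le_1) simp_all
      then have "padic_abs (of_nat n * t ^ (n - 1)) * (padic_abs k ^ 2 * S ^ 2)
          \<le> S ^ l * (padic_abs k ^ 2 * S ^ 2)"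
        using S by (intro mult_right_mono) simp_all
      then show ?thesis
        using n by (simp add: padic_abs_mult padic_abs_power power2_eq_square ac_simps)
    qed
    have "max (padic_abs ((t + k) * D)) (padic_abs (of_nat n * t ^ (n - 1) * k ^ 2)) * S ^ 2
        \<le> padic_abs k ^ 2 * S ^ Suc n"
      using 1 2 by (simp add: max_def)
    moreover have "padic_abs ((t + k) * D + of_nat n * t ^ (n - 1) * k ^ 2) * S ^ 2
      \<le> max (padic_abs ((t + k) * D)) (padic_abs (of_nat n * t ^ (n - 1) * k ^ 2)) * S ^ 2"
      by (intro mult_right_mono padic_abs_add) simp
    ultimately show ?thesis by linarith
  qed
  ultimately show ?case by simp
qed simp

lemma has_padic_deriv_of_quadratic_bound:
  assumes \<delta>: "\<delta> > 0"
    and bound: "\<And>k. padic_abs k < \<delta> \<Longrightarrow> padic_abs (f (x + k) - f x - d * k) \<le> K * padic_abs k ^ 2"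
  shows "has_padic_deriv f d x"
  unfolding has_padic_deriv_def tendsto_padic_iff
proof (rule tendsto_sandwich[OF _ _ tendsto_const])
  have "((\<lambda>y. padic_abs (y - x)) \<longlongrightarrow> 0) (at x)"
    using tendsto_ident_at[of x UNIV] by (simp add: tendsto_padic_iff)
  then show "((\<lambda>y. K * padic_abs (y - x)) \<longlongrightarrow> 0) (at x)"
    by (rule tendsto_mult_right_zero)
  have "\<forall>\<^sub>F y in nhds x. padic_abs (y - x) < \<delta>"
    using \<delta> by (auto simp: eventually_nhds_padic)
  then show "\<forall>\<^sub>F y in at x. padic_abs ((f y - f x) / (y - x) - d) \<le> K * padic_abs (y - x)"
    unfolding eventually_at_filter
  proof eventually_elim
    case (elim y)
    show ?case
    proof (intro impI)
      assume "y \<noteq> x"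
      then have nz: "y - x \<noteq> 0" "padic_abs (y - x) > 0" by (simp_all add: less_le)
      have "(f y - f x) / (y - x) - d = (f y - f x - d * (y - x)) / (y - x)"
        using nz(1) by (simp add: diff_divide_distrib)
      then have "padic_abs ((f y - f x) / (y - x) - d)
          = padic_abs (f y - f x - d * (y - x)) / padic_abs (y - x)"
        by (simp only: padic_abs_divide)
      also have "\<dots> \<le> K * padic_abs (y - x) ^ 2 / padic_abs (y - x)"
        using bound[OF elim] nz(2) by (intro divide_right_mono) simp_all
      finally show "padic_abs ((f y - f x) / (y - x) - d) \<le> K * padic_abs (y - x)"
        using nz by (simp add: power2_eq_square)
    qed
  qed
qed simp

text \<open>
  Termwise differentiation. Pick \<open>s\<close> inside the disc, at least as large as \<open>t\<close>, so that the terms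
  \<open>a n * s ^ n\<close> are bounded. For increments \<open>k\<close> smaller than \<open>s\<close> every term of the series has a
  Taylor remainder of size \<open>O(\<bar>k\<bar>\<^sup>2)\<close> uniformly in \<open>n\<close>, and by the ultrametric inequality the sum
  of the remainders obeys the same bound. Unlike over the complex numbers, \<open>s\<close> may have the same
  absolute value as \<open>t\<close>.
\<close>

lemma has_power_series_deriv:
  fixes f :: "'p::prime_card padic \<Rightarrow> 'p padic"
  assumes f: "has_power_series f a r" and r: "r > 0"
  obtains g where "has_power_series g (\<lambda>n. of_nat (Suc n) * a (Suc n)) r"
    "\<forall>t. padic_abs t < r \<longrightarrow> has_padic_deriv f (g t) t"
proof -
  have witness: "\<exists>s :: 'p padic. s \<noteq> 0 \<and> padic_abs t \<le> padic_abs s \<and> padic_abs s < r"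
    if t: "padic_abs t < r" for t :: "'p padic"
  proof (cases "t = 0")
    case True
    obtain s :: "'p padic" where "s \<noteq> 0" "padic_abs s < r" using ex_small_padic[OF r] .
    then show ?thesis using True by auto
  next
    case False
    with t show ?thesis by (intro exI[of _ t]) simp
  qed
  define g where "g t = (\<Sum>n. of_nat (Suc n) * a (Suc n) * t ^ n)" for t
  have g: "(\<lambda>n. of_nat (Suc n) * a (Suc n) * t ^ n) sums g t" if t: "padic_abs t < r" for t
  proof -
    obtain s :: "'p padic" where s: "s \<noteq> 0" "padic_abs t \<le> padic_abs s" "padic_abs s < r"
      using witness[OF t] by blast
    have "(\<lambda>n. a n * s ^ n) sums f s"
      using f s by (simp add: has_power_series_def)
    from LIMSEQ_Suc[OF sums_imp_null_padic[OF this]]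
    have "(\<lambda>n. padic_abs (a (Suc n) * s ^ Suc n)) \<longlonglongrightarrow> 0"
      by (simp only: tendsto_padic_iff diff_zero)
    then have lim: "(\<lambda>n. padic_abs (a (Suc n) * s ^ Suc n) / padic_abs s) \<longlonglongrightarrow> 0"
      by (rule tendsto_divide_zero)
    have "(\<lambda>n. of_nat (Suc n) * a (Suc n) * t ^ n) \<longlonglongrightarrow> 0"
      unfolding tendsto_padic_iff
    proof (rule tendsto_sandwich[OF _ _ tendsto_const lim])
      have "padic_abs (of_nat (Suc n) * a (Suc n) * t ^ n - 0)
          \<le> padic_abs (a (Suc n) * s ^ Suc n) / padic_abs s" for n
      proof -
        have "padic_abs (of_nat (Suc n) * a (Suc n) * t ^ n - 0)
            \<le> 1 * padic_abs (a (Suc n)) * padic_abs s ^ n"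
          unfolding padic_abs_mult padic_abs_power diff_zero
          by (intro mult_mono power_mono s(2) padic_abs_of_nat_le_1 order_refl) simp_all
        also have "\<dots> = padic_abs (a (Suc n) * s ^ Suc n) / padic_abs s"
          using s(1) by (simp add: padic_abs_mult padic_abs_power)
        finally show ?thesis .
      qed
      then show "\<forall>\<^sub>F n in sequentially. padic_abs (of_nat (Suc n) * a (Suc n) * t ^ n - 0)
          \<le> padic_abs (a (Suc n) * s ^ Suc n) / padic_abs s"
        by (intro always_eventually allI)
    qed simp
    then show ?thesis
      unfolding g_def by (intro summable_sums summable_padic)
  qed
  have "has_padic_deriv f (g t) t" if t: "padic_abs t < r" for t
  proof -
    obtain s :: "'p padic" where s: "s \<noteq> 0" "padic_abs t \<le> padic_abs s" "padic_abs s < r"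
      using witness[OF t] by blast
    have s0: "padic_abs s > 0" using s(1) by (simp add: less_le)
    have "(\<lambda>n. a n * s ^ n) sums f s"
      using f s by (simp add: has_power_series_def)
    from sums_imp_null_padic[OF this]
    have "(\<lambda>n. padic_abs (a n * s ^ n)) \<longlonglongrightarrow> 0"
      by (simp only: tendsto_padic_iff diff_zero)
    then have "Bseq (\<lambda>n. padic_abs (a n * s ^ n))"
      by (intro convergent_imp_Bseq convergentI)
    then obtain M where M: "\<And>n. padic_abs (a n * s ^ n) \<le> M"
      unfolding Bseq_def by auto
    show ?thesis
    proof (rule has_padic_deriv_of_quadratic_bound[OF s0])
      fix k :: "'p padic" assume k: "padic_abs k < padic_abs s"
      have tk: "padic_abs (t + k) < r"
        using padic_abs_add_le[of t "padic_abs s" k] s k by simp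
      have "(\<lambda>n. a n * (t + k) ^ n) sums f (t + k)" "(\<lambda>n. a n * t ^ n) sums f t"
        using f t tk by (simp_all add: has_power_series_def)
      then have 1: "(\<lambda>n. a n * (t + k) ^ n - a n * t ^ n) sums (f (t + k) - f t)"
        by (rule sums_diff_padic)
      have "(\<lambda>n. k * (of_nat (Suc n) * a (Suc n) * t ^ n)) sums (k * g t)"
        by (rule sums_mult_padic[OF g[OF t]])
      then have "(\<lambda>n. of_nat (Suc n) * a (Suc n) * t ^ (Suc n - 1) * k) sums (g t * k)"
        by (simp add: ac_simps)
      from sums_Suc[where f = "\<lambda>n. of_nat n * a n * t ^ (n - 1) * k", OF this]
      have "(\<lambda>n. of_nat n * a n * t ^ (n - 1) * k) sums (g t * k)"
        by simp
      from sums_diff_padic[OF 1 this]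
      have "(\<lambda>n. a n * ((t + k) ^ n - t ^ n - of_nat n * t ^ (n - 1) * k))
          sums (f (t + k) - f t - g t * k)"
        by (simp add: algebra_simps)
      then show "padic_abs (f (t + k) - f t - g t * k) \<le> M / padic_abs s ^ 2 * padic_abs k ^ 2"
      proof (rule sums_padic_abs_le)
        fix n
        define D where "D = (t + k) ^ n - t ^ n - of_nat n * t ^ (n - 1) * k"
        have "padic_abs (a n) * (padic_abs D * padic_abs s ^ 2)
            \<le> padic_abs (a n) * (padic_abs k ^ 2 * padic_abs s ^ n)"
          unfolding D_def using s k by (intro mult_left_mono power_remainder_bound) simp_all
        also have "\<dots> \<le> M * padic_abs k ^ 2"
          using mult_right_mono[OF M[of n], of "padic_abs k ^ 2"]
          by (simp add: padic_abs_mult padic_abs_power ac_simps)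
        finally have "padic_abs (a n * D) \<le> M / padic_abs s ^ 2 * padic_abs k ^ 2"
          using s(1) by (simp add: padic_abs_mult pos_le_divide_eq mult.assoc)
        then show "padic_abs (a n * ((t + k) ^ n - t ^ n - of_nat n * t ^ (n - 1) * k))
            \<le> M / padic_abs s ^ 2 * padic_abs k ^ 2"
          unfolding D_def .
      qed
    qed
  qed
  moreover have "has_power_series g (\<lambda>n. of_nat (Suc n) * a (Suc n)) r"
    using g by (simp add: has_power_series_def)
  ultimately show thesis using that by blast
qed

lemma has_power_series_deriv_0:
  assumes "has_power_series f a r" "r > 0"
  shows "has_padic_deriv f (a 1) 0"
proof -
  obtain g where g: "has_power_series g (\<lambda>n. of_nat (Suc n) * a (Suc n)) r"
    "\<forall>t. padic_abs t < r \<longrightarrow> has_padic_deriv f (g t) t"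
    by (rule has_power_series_deriv[OF assms])
  show ?thesis
    using g(2)[rule_format, of 0] has_power_series_at_0[OF g(1)] assms(2) by simp
qed

lemma has_padic_deriv_translate:
  assumes "has_padic_deriv f d t"
  shows "has_padic_deriv (\<lambda>y. f (y - x)) d (x + t)"
proof -
  have "has_padic_deriv (\<lambda>y. y - x) (1 - 0) (x + t)"
    by (intro has_padic_deriv_diff has_padic_deriv_ident has_padic_deriv_const)
  from has_padic_deriv_chain[OF this, of f d] assms show ?thesis by simp
qed

section \<open>The Schwarzian and Frobenius Schwarzian derivatives\<close>

lemma padic_deriv_of_power_series:
  fixes \<phi> :: "'p::prime_card padic \<Rightarrow> 'p padic"
  assumes \<phi>: "has_power_series (\<lambda>h. \<phi> (x + h)) c r" and r: "r > 0"
  shows "has_padic_deriv \<phi> (c 1) x" "has_padic_deriv (padic_deriv \<phi>) (2 * c 2) x"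
proof -
  have translate: "has_padic_deriv \<phi> d (x + t)" if "has_padic_deriv (\<lambda>h. \<phi> (x + h)) d t" for d t
    using has_padic_deriv_translate[OF that, of x] by simp
  show "has_padic_deriv \<phi> (c 1) x"
    using translate[OF has_power_series_deriv_0[OF \<phi> r]] by simp
  obtain g where g: "has_power_series g (\<lambda>n. of_nat (Suc n) * c (Suc n)) r"
    "\<forall>t. padic_abs t < r \<longrightarrow> has_padic_deriv (\<lambda>h. \<phi> (x + h)) (g t) t"
    by (rule has_power_series_deriv[OF \<phi> r])
  have "padic_deriv \<phi> y = g (y - x)" if "padic_abs (y - x) < r" for y
    using translate[of "g (y - x)" "y - x"] g(2) that by (intro has_padic_deriv_imp_deriv) simp
  then have "\<forall>\<^sub>F y in nhds x. padic_deriv \<phi> y = g (y - x)"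
    using r by (auto simp: eventually_nhds_padic)
  moreover have "has_padic_deriv (\<lambda>y. g (y - x)) (2 * c 2) x"
    using has_padic_deriv_translate[OF has_power_series_deriv_0[OF g(1) r], of x]
    by (simp add: numeral_2_eq_2)
  ultimately show "has_padic_deriv (padic_deriv \<phi>) (2 * c 2) x"
    by (rule has_padic_deriv_cong[rotated])
qed

lemma diff_quot_commute: "diff_quot \<phi> y z = diff_quot \<phi> z y"
  by (simp add: diff_quot_def) (metis minus_diff_eq minus_divide_divide)

text \<open>
  The inner derivative is needed at \<open>z = x\<close> only, for each \<open>y\<close> near \<open>x\<close>. With \<open>h = y - x\<close> the difference quotient
  at \<open>z = x\<close> is the power series \<open>q h\<close> with coefficients \<open>c 1, c 2, \<dots>\<close>. Its derivative in \<open>z\<close>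
  is \<open>\<rho> h\<close>, with coefficients \<open>c 2, c 3, \<dots>\<close>: by the quotient rule for \<open>h \<noteq> 0\<close>, and
  for \<open>h = 0\<close> because the difference quotient is symmetric. So no analysis of the difference
  quotient in two variables is required. The outer derivative is that of \<open>F' (q h) * \<rho> h\<close>
  at 0, where \<open>q\<close> has slope \<open>c 2\<close> and \<open>\<rho>\<close> has slope \<open>c 3\<close>.
\<close>

lemma mixed_deriv_diag_diff_quot:
  fixes \<phi> :: "'p::prime_card padic \<Rightarrow> 'p padic"
  assumes \<phi>: "has_power_series (\<lambda>h. \<phi> (x + h)) c r" and r: "r > 0"
    and F: "\<And>h. padic_abs h < r \<Longrightarrow>
      has_padic_deriv F (F' (diff_quot \<phi> (x + h) x)) (diff_quot \<phi> (x + h) x)"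
    and F': "has_padic_deriv F' e (c 1)"
  shows "mixed_deriv_diag (\<lambda>y z. F (diff_quot \<phi> y z)) x = e * c 2 ^ 2 + F' (c 1) * c 3"
proof -
  have c0: "\<phi> x = c 0"
    using has_power_series_at_0[OF \<phi> r] by simp
  have c1: "has_padic_deriv \<phi> (c 1) x"
    by (rule padic_deriv_of_power_series[OF \<phi> r])
  define q where "q h = (if h = 0 then c 1 else (\<phi> (x + h) - c 0) / h)" for h
  define \<rho> where "\<rho> h = (if h = 0 then c 2 else (q h - c 1) / h)" for h
  have q: "has_power_series q (\<lambda>n. c (Suc n)) r"
    unfolding q_def by (rule has_power_series_shift[OF \<phi> r])
  have \<rho>: "has_power_series \<rho> (\<lambda>n. c (Suc (Suc n))) r"
  proof -
    have "(\<lambda>t. if t = 0 then c (Suc 1) else (q t - c (Suc 0)) / t) = \<rho>"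
      by (rule ext) (simp add: \<rho>_def numeral_2_eq_2)
    then show ?thesis using has_power_series_shift[OF q r] by metis
  qed
  have q': "has_padic_deriv q (c 2) 0"
    using has_power_series_deriv_0[OF q r] by (simp add: numeral_2_eq_2)
  have \<rho>': "has_padic_deriv \<rho> (c 3) 0"
    using has_power_series_deriv_0[OF \<rho> r] by (simp add: numeral_3_eq_3)
  have dq: "diff_quot \<phi> y x = q (y - x)" for y
    using has_padic_deriv_imp_deriv[OF c1] by (simp add: diff_quot_def q_def c0)
  have z_deriv: "has_padic_deriv (\<lambda>z. diff_quot \<phi> y z) (\<rho> (y - x)) x" for y
  proof (cases "y = x")
    case True
    have "has_padic_deriv (\<lambda>z. q (z - x)) (c 2) x"
      using has_padic_deriv_translate[OF q', of x] by simp
    then show ?thesis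
      using True by (simp add: diff_quot_commute[of \<phi> x] dq \<rho>_def)
  next
    case False
    have "has_padic_deriv (\<lambda>z. \<phi> y - \<phi> z) (0 - c 1) x"
      by (intro has_padic_deriv_diff has_padic_deriv_const c1)
    moreover have "has_padic_deriv (\<lambda>z. y - z) (0 - 1) x"
      by (intro has_padic_deriv_diff has_padic_deriv_const has_padic_deriv_ident)
    then have "has_padic_deriv (\<lambda>z. inverse (y - z)) (- (1 / (y - x) ^ 2) * (0 - 1)) x"
      using False by (intro has_padic_deriv_chain[where F = inverse] has_padic_deriv_inverse) simp_all
    ultimately have "has_padic_deriv (\<lambda>z. (\<phi> y - \<phi> z) * inverse (y - z))
        ((0 - c 1) * inverse (y - x) + (\<phi> y - \<phi> x) * (- (1 / (y - x) ^ 2) * (0 - 1))) x"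
      by (rule has_padic_deriv_mult)
    moreover have "(0 - c 1) * inverse (y - x) + (\<phi> y - \<phi> x) * (- (1 / (y - x) ^ 2) * (0 - 1)) = \<rho> (y - x)"
    proof -
      have "(0 - b) * inverse u + A * (- (1 / u ^ 2) * (0 - 1)) = (A / u - b) / u"
        if "u \<noteq> 0" for u A b :: "'p padic"
        using that by (simp add: field_simps power2_eq_square)
      then show ?thesis
        using False by (simp add: \<rho>_def q_def c0)
    qed
    moreover have "\<forall>\<^sub>F z in nhds x. z \<noteq> y"
      using False by (intro t1_space_nhds) simp
    then have "\<forall>\<^sub>F z in nhds x. diff_quot \<phi> y z = (\<phi> y - \<phi> z) * inverse (y - z)"
      by (rule eventually_mono) (simp add: diff_quot_def divide_inverse)
    ultimately show ?thesis
      using has_padic_deriv_cong by metis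
  qed
  have "padic_deriv (\<lambda>z. F (diff_quot \<phi> y z)) x = F' (q (y - x)) * \<rho> (y - x)"
    if y: "padic_abs (y - x) < r" for y
    using F[OF y] by (intro has_padic_deriv_imp_deriv has_padic_deriv_chain z_deriv) (simp add: dq)
  then have "\<forall>\<^sub>F y in nhds x. padic_deriv (\<lambda>z. F (diff_quot \<phi> y z)) x = F' (q (y - x)) * \<rho> (y - x)"
    using r by (auto simp: eventually_nhds_padic)
  moreover have "has_padic_deriv (\<lambda>y. F' (q (y - x)) * \<rho> (y - x)) (e * c 2 ^ 2 + F' (c 1) * c 3) x"
  proof -
    have "has_padic_deriv (\<lambda>h. F' (q h)) (e * c 2) 0"
      using F' by (intro has_padic_deriv_chain q') (simp add: q_def)
    from has_padic_deriv_translate[OF has_padic_deriv_mult[OF this \<rho>'], of x]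
    show ?thesis
      by (simp add: q_def \<rho>_def power2_eq_square mult.assoc)
  qed
  ultimately show ?thesis
    unfolding mixed_deriv_diag_def
    by (intro has_padic_deriv_imp_deriv) (rule has_padic_deriv_cong)
qed

lemma padic_abs_eq_1:
  fixes w :: "'p::prime_card padic"
  assumes "padic_abs (w - 1) < 1" shows "padic_abs w = 1"
proof (rule antisym)
  show "padic_abs w \<le> 1"
    using padic_abs_add_le[of "w - 1" 1 1] assms by simp
  show "1 \<le> padic_abs w"
    using padic_abs_diff_less[of w 1 "w - 1"] assms by (force simp: not_less[symmetric])
qed

text \<open>
  The termwise derivative of the logarithm series at \<open>1 + t\<close> is the geometric series in \<open>- t\<close>.
\<close>

lemma has_padic_deriv_log:
  fixes w :: "'p::prime_card padic"
  assumes w: "padic_abs (w - 1) < 1"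
  shows "has_padic_deriv padic_log (inverse w) w"
proof -
  define L where "L t = padic_log (1 + t)" for t :: "'p padic"
  define a :: "nat \<Rightarrow> 'p padic" where
    "a n = (case n of 0 \<Rightarrow> 0 | Suc k \<Rightarrow> (- 1) ^ k / of_nat (Suc k))" for n
  have L: "has_power_series L a 1"
    unfolding has_power_series_def
  proof (intro allI impI)
    fix t :: "'p padic" assume t: "padic_abs t < 1"
    have "(\<lambda>n. (- 1) ^ n * t ^ Suc n / of_nat (Suc n)) \<longlonglongrightarrow> 0"
      unfolding tendsto_padic_iff
    proof (rule tendsto_sandwich[OF _ _ tendsto_const])
      have "(\<lambda>n. real n * padic_abs t ^ n) \<longlonglongrightarrow> 0"
        using powser_times_n_limit_0[of "padic_abs t"] t by simp
      then show "(\<lambda>n. real (Suc n) * padic_abs t ^ Suc n) \<longlonglongrightarrow> 0"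
        by (rule LIMSEQ_Suc)
      have "padic_abs ((- 1) ^ n * t ^ Suc n / of_nat (Suc n) - 0) \<le> real (Suc n) * padic_abs t ^ Suc n" for n
      proof -
        have "inverse (padic_abs (of_nat (Suc n) :: 'p padic)) \<le> inverse (1 / real (Suc n))"
          using padic_abs_of_nat_ge[where 'p = 'p, of "Suc n"] by (intro le_imp_inverse_le) simp_all
        then have "padic_abs t ^ Suc n * inverse (padic_abs (of_nat (Suc n) :: 'p padic))
            \<le> padic_abs t ^ Suc n * real (Suc n)"
          by (intro mult_left_mono) simp_all
        then show ?thesis
          by (simp only: padic_abs_mult padic_abs_power padic_abs_inverse padic_abs_minus padic_abs_1
              power_one mult_1_left diff_zero divide_inverse mult.commute)
      qed
      then show "\<forall>\<^sub>F n in sequentially.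
          padic_abs ((- 1) ^ n * t ^ Suc n / of_nat (Suc n) - 0) \<le> real (Suc n) * padic_abs t ^ Suc n"
        by (intro always_eventually allI)
    qed simp
    then have "(\<lambda>n. (- 1) ^ n * t ^ Suc n / of_nat (Suc n)) sums L t"
      unfolding L_def padic_log_def using summable_sums[OF summable_padic] by simp
    then have "(\<lambda>n. a (Suc n) * t ^ Suc n) sums L t"
      by (simp add: a_def)
    from sums_Suc[where f = "\<lambda>n. a n * t ^ n", OF this] show "(\<lambda>n. a n * t ^ n) sums L t"
      by (simp add: a_def)
  qed
  obtain g where g: "has_power_series g (\<lambda>n. of_nat (Suc n) * a (Suc n)) 1"
    "\<forall>t. padic_abs t < 1 \<longrightarrow> has_padic_deriv L (g t) t"
    by (rule has_power_series_deriv[OF L]) simp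
  define t where "t = w - 1"
  have t: "padic_abs t < 1" using w by (simp add: t_def)
  have "of_nat (Suc n) * a (Suc n) = (- 1) ^ n" for n
    unfolding a_def by (simp del: of_nat_Suc)
  then have sums: "(\<lambda>n. (- 1) ^ n * t ^ n) sums g t"
    using g(1) t by (simp add: has_power_series_def)
  \<comment> \<open>Two evaluations of the geometric series without its first term determine its sum.\<close>
  have "(\<lambda>n. (- 1) ^ Suc n * t ^ Suc n) sums (g t - 1)"
    using sums_shift_padic[OF sums] by simp
  moreover have "(\<lambda>n. (- 1) ^ Suc n * t ^ Suc n) sums (- t * g t)"
    using sums_mult_padic[OF sums, of "- t"] by (simp add: ac_simps)
  ultimately have "g t - 1 = - t * g t"
    by (rule sums_unique2)
  then have "g t * w = 1"
    by (simp add: t_def algebra_simps)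
  then have "g t = inverse w"
    by (metis inverse_unique mult.commute)
  then have "has_padic_deriv L (inverse w) t"
    using g(2) t by metis
  from has_padic_deriv_translate[OF this, of 1] show ?thesis
    by (simp add: L_def t_def)
qed

text \<open>
  Raising to the power \<open>p\<close> contracts the open unit disc about 1: in
  \<open>v ^ p - 1 = (v - 1) * (1 + v + \<dots> + v ^ (p - 1))\<close> the second factor is \<open>p\<close> plus terms
  \<open>v ^ i - 1\<close>, hence of absolute value at most \<open>\<kappa> = max (1 / p) \<bar>w - 1\<bar>\<close>, a number below 1.
\<close>

lemma power_prime_power_tendsto_1:
  fixes w :: "'p::prime_card padic"
  assumes w: "padic_abs (w - 1) < 1"
  shows "(\<lambda>m. w ^ (CARD('p) ^ m)) \<longlonglongrightarrow> 1"
proof -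
  define \<kappa> where "\<kappa> = max (1 / real CARD('p)) (padic_abs (w - 1))"
  have p: "CARD('p) > 1" using prime_gt_1_nat[OF prime_card] .
  have \<kappa>: "0 \<le> \<kappa>" "\<kappa> < 1" using w p by (auto simp: \<kappa>_def le_max_iff_disj)
  have step: "padic_abs (v ^ CARD('p) - 1) \<le> \<kappa> * padic_abs (v - 1)"
    if v: "padic_abs (v - 1) \<le> padic_abs (w - 1)" for v :: "'p padic"
  proof -
    have v1: "padic_abs v = 1" using v w by (intro padic_abs_eq_1) simp
    have pow: "padic_abs (v ^ i - 1) \<le> \<kappa>" for i
    proof -
      have "padic_abs (v ^ i - 1) = padic_abs (v - 1) * padic_abs (\<Sum>j<i. v ^ j)"
        by (simp add: power_diff_1_eq padic_abs_mult)
      also have "\<dots> \<le> padic_abs (v - 1) * 1"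
        by (intro mult_left_mono padic_abs_sum_le) (simp_all add: padic_abs_power v1)
      finally show ?thesis using v by (simp add: \<kappa>_def)
    qed
    have "(\<Sum>i<CARD('p). v ^ i) = of_nat CARD('p) + (\<Sum>i<CARD('p). v ^ i - 1)"
      by (simp add: sum_subtractf)
    also have "padic_abs \<dots> \<le> \<kappa>"
    proof (intro padic_abs_add_le padic_abs_sum_le \<kappa> pow)
      show "padic_abs (of_nat CARD('p) :: 'p padic) \<le> \<kappa>"
        by (simp add: padic_abs_of_prime \<kappa>_def)
    qed
    finally have "padic_abs (v - 1) * padic_abs (\<Sum>i<CARD('p). v ^ i) \<le> padic_abs (v - 1) * \<kappa>"
      by (intro mult_left_mono) simp_all
    then show ?thesis
      by (simp add: power_diff_1_eq padic_abs_mult mult.commute)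
  qed
  have bound: "padic_abs (w ^ (CARD('p) ^ m) - 1) \<le> \<kappa> ^ m * padic_abs (w - 1)" for m
  proof (induction m)
    case (Suc m)
    have "\<kappa> ^ m * padic_abs (w - 1) \<le> 1 * padic_abs (w - 1)"
      using \<kappa> by (intro mult_right_mono power_le_one) simp_all
    then have "padic_abs ((w ^ (CARD('p) ^ m)) ^ CARD('p) - 1) \<le> \<kappa> * padic_abs (w ^ (CARD('p) ^ m) - 1)"
      using Suc.IH by (intro step) linarith
    also have "\<dots> \<le> \<kappa> * (\<kappa> ^ m * padic_abs (w - 1))"
      using Suc.IH \<kappa>(1) by (rule mult_left_mono)
    finally show ?case by (simp add: power_mult[symmetric] ac_simps)
  qed simp
  show ?thesis
    unfolding tendsto_padic_iff
  proof (rule tendsto_sandwich[OF _ _ tendsto_const])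
    show "\<forall>\<^sub>F m in sequentially. padic_abs (w ^ (CARD('p) ^ m) - 1) \<le> \<kappa> ^ m * padic_abs (w - 1)"
      by (intro always_eventually allI bound)
    show "(\<lambda>m. \<kappa> ^ m * padic_abs (w - 1)) \<longlonglongrightarrow> 0"
      using LIMSEQ_power_zero[of \<kappa>] \<kappa> by (intro tendsto_mult_left_zero) simp
  qed simp
qed

lemma Diff_an_power_series:
  fixes \<phi> :: "'p::prime_card padic \<Rightarrow> 'p padic"
  assumes \<phi>: "\<phi> \<in> Diff_an \<epsilon>" and x: "x \<in> padic_ball \<epsilon>"
  obtains c r where "r > 0" "\<forall>h. padic_abs h < r \<longrightarrow> x + h \<in> padic_ball \<epsilon>"
    "has_power_series (\<lambda>h. \<phi> (x + h)) c r"
proof -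
  obtain f where f: "\<And>y. y \<in> padic_ball \<epsilon> \<Longrightarrow> \<phi> y = y + f y" "f locally_analytic_on padic_ball \<epsilon>"
    using \<phi> unfolding Diff_an_def by blast
  obtain r0 b where r0: "r0 > 0"
    and b: "\<And>y. y \<in> padic_ball \<epsilon> \<Longrightarrow> padic_abs (y - x) < r0 \<Longrightarrow> (\<lambda>n. b n * (y - x) ^ n) sums f y"
    using f(2) x unfolding locally_analytic_on_def by blast
  define r where "r = min r0 \<epsilon>"
  have "\<epsilon> > 0" using x padic_abs_ge_0[of x] unfolding padic_ball_def mem_Collect_eq by linarith
  then have r: "r > 0" using r0 by (simp add: r_def)
  have ball: "x + h \<in> padic_ball \<epsilon>" if "padic_abs h < r" for h
    using that x by (simp add: padic_ball_def r_def padic_abs_add_less)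
  define c where "c n = (if n = 0 then x else 0) + (if n = 1 then 1 else 0) + b n" for n
  have "has_power_series (\<lambda>h. \<phi> (x + h)) c r"
    unfolding has_power_series_def
  proof (intro allI impI)
    fix h :: "'p padic" assume h: "padic_abs h < r"
    have "(\<lambda>n. (if n = 0 then x * h ^ n else 0) + (if n = 1 then h ^ n else 0) + b n * h ^ n)
        sums (x * h ^ 0 + h ^ 1 + f (x + h))"
      using b[OF ball[OF h]] h by (intro sums_add sums_single) (simp add: r_def)
    then have "(\<lambda>n. c n * h ^ n) sums (x + h + f (x + h))"
      by (simp add: c_def distrib_right if_distrib[of "\<lambda>u. u * _"] cong: if_cong)
    then show "(\<lambda>n. c n * h ^ n) sums \<phi> (x + h)"
      using f(1)[OF ball[OF h]] by simp
  qed
  then show thesis using that r ball by blast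
qed

text \<open>
  Off the diagonal this is the Lipschitz bound on \<open>f = \<phi> - id\<close>. The diagonal value is a limit of
  such quotients, and open discs about 1 are also closed.
\<close>

lemma Diff_an_diff_quot:
  fixes \<phi> :: "'p::prime_card padic \<Rightarrow> 'p padic"
  assumes \<phi>: "\<phi> \<in> Diff_an \<epsilon>" and y: "y \<in> padic_ball \<epsilon>" and z: "z \<in> padic_ball \<epsilon>"
  shows "padic_abs (diff_quot \<phi> y z - 1) < 1"
proof -
  have off: "padic_abs ((\<phi> u - \<phi> v) / (u - v) - 1) < 1"
    if uv: "u \<in> padic_ball \<epsilon>" "v \<in> padic_ball \<epsilon>" "u \<noteq> v" for u v
  proof -
    obtain f L where f: "\<And>y. y \<in> padic_ball \<epsilon> \<Longrightarrow> \<phi> y = y + f y"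
      and L: "L < 1" "lip_seminorm (padic_ball \<epsilon>) f \<le> ereal L"
      using \<phi> unfolding Diff_an_def by blast
    have "ereal (padic_abs (f u - f v) / padic_abs (u - v)) \<le> lip_seminorm (padic_ball \<epsilon>) f"
      unfolding lip_seminorm_def using uv by (intro SUP_upper2[of "(u, v)"]) auto
    then have "padic_abs (f u - f v) / padic_abs (u - v) \<le> L"
      using L(2) by (metis ereal_less_eq(3) order_trans)
    moreover have "(\<phi> u - \<phi> v) / (u - v) - 1 = (f u - f v) / (u - v)"
      using uv by (simp add: f field_simps)
    ultimately show ?thesis
      using L(1) by (simp add: padic_abs_divide)
  qed
  show ?thesis
  proof (cases "y = z")
    case False
    then show ?thesis using off[OF y z] by (simp add: diff_quot_def)
  next
    case True
    obtain c r where r: "r > 0" and ball: "\<forall>h. padic_abs h < r \<longrightarrow> y + h \<in> padic_ball \<epsilon>"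
      and c: "has_power_series (\<lambda>h. \<phi> (y + h)) c r"
      by (rule Diff_an_power_series[OF \<phi> y])
    have d: "has_padic_deriv \<phi> (c 1) y"
      by (rule padic_deriv_of_power_series[OF c r])
    have "\<forall>\<^sub>F u in at y. padic_abs ((\<phi> u - \<phi> y) / (u - y) - c 1) < 1"
      using d unfolding has_padic_deriv_def tendsto_padic_iff by (rule order_tendstoD(2)) simp
    moreover have "\<forall>\<^sub>F u in nhds y. u \<in> padic_ball \<epsilon>"
      unfolding eventually_nhds_padic
      using ball[rule_format, of "u - y" for u] r by (intro exI[of _ r]) simp
    then have "\<forall>\<^sub>F u in at y. u \<in> padic_ball \<epsilon>"
      unfolding eventually_at_filter by (rule eventually_mono) simp
    moreover have "\<forall>\<^sub>F u in at y. u \<noteq> y"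
      by (simp add: eventually_at_filter)
    ultimately have "\<forall>\<^sub>F u in at y. padic_abs (c 1 - 1) < 1"
    proof eventually_elim
      case (elim u)
      show ?case
        using padic_abs_diff_less[OF off[OF elim(2) y elim(3)] elim(1)] by simp
    qed
    then have "padic_abs (c 1 - 1) < 1"
      by (simp add: eventually_const)
    then show ?thesis
      using True has_padic_deriv_imp_deriv[OF d] by (simp add: diff_quot_def)
  qed
qed

text \<open>
  Both Schwarzians come from the same formula for the mixed derivative, with outer function
  \<open>log\<close>, whose derivatives are \<open>1 / w\<close> and \<open>- 1 / w ^ 2\<close>, and with \<open>(w ^ N - 1) / N\<close> for
  \<open>N = p ^ m\<close>, whose derivatives are \<open>w ^ N / w\<close> and \<open>(N - 1) * w ^ N / w ^ 2\<close>. Up to the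
  factor \<open>w ^ N\<close> they differ only in the coefficient \<open>N - 1\<close> in place of \<open>- 1\<close>.
\<close>

lemma schwarzian_power_series:
  fixes \<phi> :: "'p::prime_card padic \<Rightarrow> 'p padic"
  assumes \<phi>: "has_power_series (\<lambda>h. \<phi> (x + h)) c r" and r: "r > 0"
    and unit: "\<And>h. padic_abs h < r \<Longrightarrow> padic_abs (diff_quot \<phi> (x + h) x - 1) < 1"
  shows "schwarzian \<phi> x = 6 * (c 3 / c 1 - c 2 ^ 2 / c 1 ^ 2)"
    and "frobenius_schwarzian m \<phi> x = 6 * c 1 ^ (CARD('p) ^ m) *
      (c 3 / c 1 + (of_nat (CARD('p) ^ m) - 1) * c 2 ^ 2 / c 1 ^ 2)"
proof -
  have d: "padic_deriv \<phi> x = c 1"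
    by (rule has_padic_deriv_imp_deriv[OF padic_deriv_of_power_series(1)[OF \<phi> r]])
  have nz: "w \<noteq> 0" if "padic_abs (w - 1) < 1" for w :: "'p padic"
    using padic_abs_eq_1[OF that] by auto
  have c1: "c 1 \<noteq> 0"
    using nz unit[of 0] r d by (simp add: diff_quot_def)
  have "mixed_deriv_diag (schwarzian_potential \<phi>) x = - (1 / c 1 ^ 2) * c 2 ^ 2 + inverse (c 1) * c 3"
    unfolding schwarzian_potential_def[abs_def]
    by (rule mixed_deriv_diag_diff_quot[OF \<phi> r has_padic_deriv_log[OF unit] has_padic_deriv_inverse[OF c1]])
  then show "schwarzian \<phi> x = 6 * (c 3 / c 1 - c 2 ^ 2 / c 1 ^ 2)"
    by (simp only: schwarzian_def) (simp add: divide_inverse algebra_simps)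
  define N where "N = CARD('p) ^ m"
  have N: "(of_nat N :: 'p padic) \<noteq> 0" by (simp add: N_def)
  have F: "has_padic_deriv (\<lambda>w. 1 / of_nat N * (w ^ N - 1)) (w ^ N * inverse w) w"
    if "w \<noteq> 0" for w :: "'p padic"
  proof -
    have "has_padic_deriv (\<lambda>w. 1 / of_nat N * (w ^ N - 1))
        (0 * (w ^ N - 1) + 1 / of_nat N * (of_nat N * w ^ N / w - 0)) w"
      by (intro has_padic_deriv_mult has_padic_deriv_diff has_padic_deriv_power has_padic_deriv_const that)
    moreover have "0 * (w ^ N - 1) + 1 / of_nat N * (of_nat N * w ^ N / w - 0) = w ^ N * inverse w"
      using N that by (simp add: field_simps)
    ultimately show ?thesis by simp
  qed
  have F': "has_padic_deriv (\<lambda>w. w ^ N * inverse w)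
      (of_nat N * c 1 ^ N / c 1 * inverse (c 1) + c 1 ^ N * - (1 / c 1 ^ 2)) (c 1)"
    by (intro has_padic_deriv_mult has_padic_deriv_power has_padic_deriv_inverse c1)
  have "mixed_deriv_diag (frobenius_potential m \<phi>) x =
      (of_nat N * c 1 ^ N / c 1 * inverse (c 1) + c 1 ^ N * - (1 / c 1 ^ 2)) * c 2 ^ 2
      + c 1 ^ N * inverse (c 1) * c 3"
    unfolding frobenius_potential_def[abs_def] N_def[symmetric]
    by (rule mixed_deriv_diag_diff_quot[OF \<phi> r F[OF nz[OF unit]] F'])
  also have "\<dots> = c 1 ^ N * (c 3 / c 1 + (of_nat N - 1) * c 2 ^ 2 / c 1 ^ 2)"
    using c1 by (simp add: divide_inverse power2_eq_square algebra_simps)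
  finally show "frobenius_schwarzian m \<phi> x = 6 * c 1 ^ (CARD('p) ^ m) *
      (c 3 / c 1 + (of_nat (CARD('p) ^ m) - 1) * c 2 ^ 2 / c 1 ^ 2)"
    unfolding frobenius_schwarzian_def N_def by (simp only: mult.assoc)
qed

theorem proposition3p25:
  fixes \<gamma> :: int and \<epsilon> :: real and \<phi> :: "'p::prime_card padic \<Rightarrow> 'p padic"
  assumes "\<epsilon> = real CARD('p) powi \<gamma>"
    and "\<phi> \<in> Diff_an \<epsilon>"
  shows "(\<forall>m. \<forall>x\<in>padic_ball \<epsilon>.
            frobenius_schwarzian m \<phi> x =
              (3 * of_nat (CARD('p) ^ m) / 2 * (padic_deriv (padic_deriv \<phi>) x / padic_deriv \<phi> x) ^ 2
                 + schwarzian \<phi> x) * padic_deriv \<phi> x ^ (CARD('p) ^ m)) \<and>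
         (\<forall>x\<in>padic_ball \<epsilon>. (\<lambda>m. frobenius_schwarzian m \<phi> x) \<longlonglongrightarrow> schwarzian \<phi> x)"
proof -
  have formula: "frobenius_schwarzian m \<phi> x =
      (3 * of_nat (CARD('p) ^ m) / 2 * (padic_deriv (padic_deriv \<phi>) x / padic_deriv \<phi> x) ^ 2
         + schwarzian \<phi> x) * padic_deriv \<phi> x ^ (CARD('p) ^ m)"
    if x: "x \<in> padic_ball \<epsilon>" for m x
  proof -
    obtain c r where r: "r > 0" and ball: "\<forall>h. padic_abs h < r \<longrightarrow> x + h \<in> padic_ball \<epsilon>"
      and c: "has_power_series (\<lambda>h. \<phi> (x + h)) c r"
      by (rule Diff_an_power_series[OF assms(2) x])
    have unit: "padic_abs (diff_quot \<phi> (x + h) x - 1) < 1" if "padic_abs h < r" for h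
      using Diff_an_diff_quot[OF assms(2) _ x] ball that by blast
    note d = padic_deriv_of_power_series[OF c r, THEN has_padic_deriv_imp_deriv]
    have alg: "6 * C * (b3 / b1 + (N - 1) * b2 ^ 2 / b1 ^ 2)
        = (3 * N / 2 * (2 * b2 / b1) ^ 2 + 6 * (b3 / b1 - b2 ^ 2 / b1 ^ 2)) * C"
      for C N b1 b2 b3 :: "'p padic"
      by (simp add: power_divide power_mult_distrib diff_divide_distrib algebra_simps)
    have S: "schwarzian \<phi> x = 6 * (c 3 / c 1 - c 2 ^ 2 / c 1 ^ 2)"
      by (rule schwarzian_power_series(1)[OF c r]) (rule unit)
    have "frobenius_schwarzian m \<phi> x = 6 * c 1 ^ (CARD('p) ^ m) *
        (c 3 / c 1 + (of_nat (CARD('p) ^ m) - 1) * c 2 ^ 2 / c 1 ^ 2)"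
      by (rule schwarzian_power_series(2)[OF c r]) (rule unit)
    then show ?thesis
      unfolding S d alg .
  qed
  have "(\<lambda>m. frobenius_schwarzian m \<phi> x) \<longlonglongrightarrow> schwarzian \<phi> x" if x: "x \<in> padic_ball \<epsilon>" for x
  proof -
    let ?q = "(padic_deriv (padic_deriv \<phi>) x / padic_deriv \<phi> x) ^ 2"
    have "padic_abs (padic_deriv \<phi> x - 1) < 1"
      using Diff_an_diff_quot[OF assms(2) x x] by (simp add: diff_quot_def)
    then have "(\<lambda>m. padic_deriv \<phi> x ^ (CARD('p) ^ m)) \<longlonglongrightarrow> 1"
      by (rule power_prime_power_tendsto_1)
    then have "(\<lambda>m. (3 / 2 * ?q * of_nat (CARD('p) ^ m) + schwarzian \<phi> x) * padic_deriv \<phi> x ^ (CARD('p) ^ m))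
        \<longlonglongrightarrow> (3 / 2 * ?q * 0 + schwarzian \<phi> x) * 1"
      by (intro tendsto_mult tendsto_add tendsto_const of_nat_prime_power_tendsto_0)
    then show ?thesis
      by (simp add: formula[OF x] ac_simps)
  qed
  with formula show ?thesis by blast
qed

end
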